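(* Let $A\in\mathrm{GL}(n,\mathbb{Z})$ be hyperbolic. If $C(A)=\langle A\rangle\times\langle J\rangle$ where the order of $J$ is $2^b$ for some $b\in\mathbb{N}$, and $|\mathrm{Per}^1(A)|>|\mathrm{Per}^1(-I)|$, then $Z(f)$ is trivial, i.e. $Z(f)=\langle f\rangle$, for all $f\in\mathcal{U}_1(A)$.
   Context: A matrix $A\in\mathrm{GL}(n,\mathbb{Z})$ (integer entries, determinant $\pm1$) is identified with the automorphism it induces on $\mathbb{T}^n=\mathbb{R}^n/\mathbb{Z}^n$; $A$ is hyperbolic if it has no eigenvalue of modulus one. $I$ is the $n\times n$ identity. $C(A)=\{B\in\mathrm{GL}(n,\mathbb{Z}):BA=AB\}$, and $C(A)=\langle A\rangle\times\langle J\rangle$ means that $J\in C(A)$ and $C(A)$ is the internal direct product of the cyclic subgroups generated by $A$ and $J$. For a map $f$ of $\mathbb{T}^n$ and $k\in\mathbb{N}$, $\mathrm{Per}^k(f)=\{\theta: f^k(\theta)=\theta\}$. For $f\in\mathrm{Diff}^1(\mathbb{T}^n)$, $Z(f)=\{g\in\mathrm{Diff}^1(\mathbb{T}^n):fg=gf\}$ and $\langle f\rangle=\{f^k:k\in\mathbb{Z}\}$. By structural stability of Anosov diffeomorphisms, there is an open neighbourhood $\mathcal{U}(A)$ of $A$ in $\mathrm{Diff}^1(\mathbb{T}^n)$ ($C^1$ topology) such that every $f\in\mathcal{U}(A)$ is Anosov and there is a homeomorphism $h_f$ of $\mathbb{T}^n$ (close to the identity) with $h_f f h_f^{-1}=A$;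 fix such $\mathcal{U}(A)$ and $h_f$. For $k\in\mathbb{N}$, $\mathcal{U}_k(A)$ denotes a (nonempty) open subset of $\mathcal{U}(A)\setminus\{A\}$ such that for every $f\in\mathcal{U}_k(A)$ any two distinct $k$-periodic orbits have different spectra: if $\theta,\theta'\in\mathrm{Per}^k(f)$ lie in distinct $f$-orbits, then $D_\theta f^k$ and $D_{\theta'}f^k$ have different spectra (in particular are not similar). *)

theory Defs
  imports
    "HOL-Analysis.Analysis"
    "HOL-Algebra.Generated_Groups"
    "HOL-Algebra.Multiplicative_Group"
begin

section \<open>The torus\<close>

definition lattice_rel :: "real ^ 'n \<Rightarrow> real ^ 'n \<Rightarrow> bool" where
  "lattice_rel x y \<longleftrightarrow> (\<forall>i. x $ i - y $ i \<in> \<int>)"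

lemma equivp_lattice_rel: "equivp lattice_rel"
proof (rule equivpI)
  show "reflp lattice_rel"
    by (auto simp: reflp_def lattice_rel_def)
  show "symp lattice_rel"
    unfolding symp_def lattice_rel_def by (metis Ints_minus minus_diff_eq)
  show "transp lattice_rel"
    unfolding transp_def lattice_rel_def
  proof (intro allI impI)
    fix x y z :: "real ^ 'n" and i
    assume "\<forall>i. x $ i - y $ i \<in> \<int>" "\<forall>i. y $ i - z $ i \<in> \<int>"
    then have "(x $ i - y $ i) + (y $ i - z $ i) \<in> \<int>" by (blast intro: Ints_add)
    then show "x $ i - z $ i \<in> \<int>" by simp
  qed
qed

quotient_type 'n torus = "(real, 'n::finite) vec" / lattice_rel
  morphisms rep_torus to_torus
  by (rule equivp_lattice_rel)

lemma to_torus_eq_iff: "to_torus x = to_torus y \<longleftrightarrow> lattice_rel x y"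
  by (simp add: torus.abs_eq_iff)

lemma to_torus_surj: obtains x where "\<theta> = to_torus x"
  by (metis Quotient_abs_rep Quotient_torus)

text \<open>The flat quotient metric; \<open>open_torus_iff\<close> below shows that it induces the quotient topology.\<close>

instantiation torus :: (finite) metric_space
begin

definition dist_torus :: "'a torus \<Rightarrow> 'a torus \<Rightarrow> real" where
  "dist_torus \<theta> \<theta>' = Inf {norm (x - y) |x y. to_torus x = \<theta> \<and> to_torus y = \<theta>'}"

definition uniformity_torus :: "('a torus \<times> 'a torus) filter" where
  "uniformity_torus = (INF e\<in>{0<..}. principal {(\<theta>, \<theta>'). dist \<theta> \<theta>' < e})"

definition open_torus :: "'a torus set \<Rightarrow> bool" where
  "open_torus U \<longleftrightarrow> (\<forall>\<theta>\<in>U. \<forall>\<^sub>F (\<theta>', \<theta>'') in uniformity. \<theta>' = \<theta> \<longrightarrow> \<theta>'' \<in> U)"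

lemma torus_dist_lessD:
  fixes \<theta> \<theta>' :: "'a torus"
  assumes "dist \<theta> \<theta>' < e" "to_torus x = \<theta>"
  obtains y where "to_torus y = \<theta>'" "norm (x - y) < e"
proof -
  let ?S = "{norm (x - y) |x y. to_torus x = \<theta> \<and> to_torus y = \<theta>'}"
  obtain y0 where "to_torus y0 = \<theta>'" by (metis to_torus_surj)
  then have "?S \<noteq> {}" using assms(2) by blast
  then obtain u v where uv: "to_torus u = \<theta>" "to_torus v = \<theta>'" "norm (u - v) < e"
    using cInf_lessD[of ?S e] assms(1) unfolding dist_torus_def by auto
  let ?y = "v + (x - u)"
  have "lattice_rel x u" using assms(2) uv(1) to_torus_eq_iff by metis
  then have "lattice_rel ?y v" by (simp add: lattice_rel_def)
  then have "to_torus ?y = \<theta>'" using to_torus_eq_iff[of ?y v] uv(2) by simp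
  moreover have "norm (x - ?y) < e" using uv(3) by (simp add: algebra_simps)
  ultimately show ?thesis by (rule that)
qed

lemma torus_dist_le:
  fixes \<theta> \<theta>' :: "'a torus"
  assumes "to_torus x = \<theta>" "to_torus y = \<theta>'"
  shows "dist \<theta> \<theta>' \<le> norm (x - y)"
  unfolding dist_torus_def using assms
  by (intro cInf_lower) (auto intro!: bdd_belowI[of _ 0])

instance
proof
  show "uniformity = (INF e\<in>{0<..}. principal {(\<theta>, \<theta>' :: 'a torus). dist \<theta> \<theta>' < e})"
    by (rule uniformity_torus_def)
  show "open U \<longleftrightarrow> (\<forall>\<theta>\<in>U. \<forall>\<^sub>F (\<theta>', \<theta>'') in uniformity. \<theta>' = \<theta> \<longrightarrow> \<theta>'' \<in> U)"
    for U :: "'a torus set"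
    by (rule open_torus_def)
next
  fix \<theta> \<theta>' :: "'a torus"
  have nonneg: "0 \<le> dist \<theta> \<theta>'"
  proof -
    obtain x y where "to_torus x = \<theta>" "to_torus y = \<theta>'" by (metis to_torus_surj)
    then have "{norm (x - y) |x y. to_torus x = \<theta> \<and> to_torus y = \<theta>'} \<noteq> {}" by blast
    then show ?thesis unfolding dist_torus_def by (rule cInf_greatest) auto
  qed
  show "dist \<theta> \<theta>' = 0 \<longleftrightarrow> \<theta> = \<theta>'"
  proof
    assume "\<theta> = \<theta>'"
    obtain x where "to_torus x = \<theta>" by (metis to_torus_surj)
    from torus_dist_le[OF this this] nonneg show "dist \<theta> \<theta>' = 0" using \<open>\<theta> = \<theta>'\<close> by simp
  next
    assume d: "dist \<theta> \<theta>' = 0"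
    obtain x y where xy: "to_torus x = \<theta>" "to_torus y = \<theta>'" by (metis to_torus_surj)
    have "x $ i - y $ i \<in> \<int>" for i
    proof -
      have "\<exists>m\<in>\<int>. dist m (x $ i - y $ i) < e" if "e > 0" for e
      proof -
        obtain z where z: "to_torus z = \<theta>'" "norm (x - z) < e"
          using torus_dist_lessD[of \<theta> \<theta>' e x] d xy \<open>e > 0\<close> by auto
        have "lattice_rel z y" using z xy to_torus_eq_iff by metis
        then have "z $ i - y $ i \<in> \<int>" by (simp add: lattice_rel_def)
        moreover have "dist (z $ i - y $ i) (x $ i - y $ i) < e"
          using component_le_norm_cart[of "x - z" i] z(2) by (simp add: dist_real_def)
        ultimately show ?thesis by blast
      qed
      then have "x $ i - y $ i \<in> closure \<int>" unfolding closure_approachable by blast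
      then show ?thesis using closure_closed[OF closed_Ints] by blast
    qed
    then have "lattice_rel x y" by (simp add: lattice_rel_def)
    then show "\<theta> = \<theta>'" using xy to_torus_eq_iff by metis
  qed
next
  fix \<theta> \<theta>' \<xi> :: "'a torus"
  show "dist \<theta> \<theta>' \<le> dist \<theta> \<xi> + dist \<theta>' \<xi>"
  proof (rule field_le_epsilon)
    fix e :: real assume "e > 0"
    obtain x where x: "to_torus x = \<xi>" by (metis to_torus_surj)
    have sym: "dist \<alpha> \<beta> \<le> dist \<beta> \<alpha>" for \<alpha> \<beta> :: "'a torus"
    proof (rule field_le_epsilon)
      fix e :: real assume "e > 0"
      obtain u where u: "to_torus u = \<beta>" by (metis to_torus_surj)
      then obtain v where "to_torus v = \<alpha>" "norm (u - v) < dist \<beta> \<alpha> + e"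
        using torus_dist_lessD[of \<beta> \<alpha> "dist \<beta> \<alpha> + e" u] \<open>e > 0\<close> by auto
      then show "dist \<alpha> \<beta> \<le> dist \<beta> \<alpha> + e"
        using torus_dist_le[of v \<alpha> u \<beta>] u by (simp add: norm_minus_commute)
    qed
    obtain u where u: "to_torus u = \<theta>" "norm (x - u) < dist \<theta> \<xi> + e / 2"
      using torus_dist_lessD[of \<xi> \<theta> "dist \<theta> \<xi> + e / 2" x] sym[of \<xi> \<theta>] \<open>e > 0\<close> x by auto
    obtain v where v: "to_torus v = \<theta>'" "norm (x - v) < dist \<theta>' \<xi> + e / 2"
      using torus_dist_lessD[of \<xi> \<theta>' "dist \<theta>' \<xi> + e / 2" x] sym[of \<xi> \<theta>'] \<open>e > 0\<close> x by auto
    have "dist \<theta> \<theta>' \<le> norm (u - v)" by (rule torus_dist_le[OF u(1) v(1)])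
    also have "\<dots> \<le> norm (x - u) + norm (x - v)"
      using norm_triangle_ineq4[of "x - v" "x - u"] by simp
    finally show "dist \<theta> \<theta>' \<le> dist \<theta> \<xi> + dist \<theta>' \<xi> + e" using u v by simp
  qed
qed

end

lemma open_torus_iff: "open U \<longleftrightarrow> open (to_torus -` U)" for U :: "'n::finite torus set"
proof
  assume U: "open U"
  show "open (to_torus -` U)"
    unfolding open_dist
  proof
    fix x assume "x \<in> to_torus -` U"
    then obtain e where e: "e > 0" "\<And>\<theta>. dist \<theta> (to_torus x) < e \<Longrightarrow> \<theta> \<in> U"
      using U unfolding open_dist by auto
    have "to_torus y \<in> U" if "dist y x < e" for y
      using torus_dist_le[of y "to_torus y" x "to_torus x"] that e(2) by (simp add: dist_norm)
    then show "\<exists>e>0. \<forall>y. dist y x < e \<longrightarrow> y \<in> to_torus -` U" using e(1) by auto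
  qed
next
  assume U: "open (to_torus -` U)"
  show "open U"
    unfolding open_dist
  proof
    fix \<theta> assume "\<theta> \<in> U"
    obtain x where x: "to_torus x = \<theta>" by (metis to_torus_surj)
    with U \<open>\<theta> \<in> U\<close> obtain e where e: "e > 0" "\<And>y. dist y x < e \<Longrightarrow> to_torus y \<in> U"
      unfolding open_dist by auto
    have "\<theta>' \<in> U" if "dist \<theta>' \<theta> < e" for \<theta>'
    proof -
      from that obtain y where "to_torus y = \<theta>'" "norm (x - y) < e"
        using torus_dist_lessD[of \<theta> \<theta>' e x] x by (auto simp: dist_commute)
      then show ?thesis using e(2)[of y] by (auto simp: dist_norm norm_minus_commute)
    qed
    then show "\<exists>e>0. \<forall>\<theta>'. dist \<theta>' \<theta> < e \<longrightarrow> \<theta>' \<in> U" using e(1) by auto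
  qed
qed

section \<open>Integer matrices and toral automorphisms\<close>

definition GLZ :: "(int ^ 'n ^ 'n::finite) monoid" where
  "GLZ = \<lparr>carrier = {A. det A = 1 \<or> det A = - 1}, mult = (**), one = mat 1\<rparr>"

definition cspectrum :: "complex ^ 'n ^ 'n::finite \<Rightarrow> complex set" where
  "cspectrum M = {\<mu>. \<exists>v. v \<noteq> 0 \<and> M *v v = \<mu> *s v}"

definition hyperbolic :: "int ^ 'n ^ 'n::finite \<Rightarrow> bool" where
  "hyperbolic A \<longleftrightarrow> (\<forall>\<mu>\<in>cspectrum (map_matrix of_int A). cmod \<mu> \<noteq> 1)"

definition centralizer_GLZ :: "int ^ 'n ^ 'n::finite \<Rightarrow> (int ^ 'n ^ 'n) set" where
  "centralizer_GLZ A = {B \<in> carrier GLZ. B ** A = A ** B}"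

lift_definition torus_map :: "int ^ 'n ^ 'n::finite \<Rightarrow> 'n torus \<Rightarrow> 'n torus"
  is "\<lambda>A x. map_matrix real_of_int A *v x"
proof -
  fix A :: "int ^ 'n ^ 'n" and x y :: "real ^ 'n"
  assume "lattice_rel x y"
  then have "(\<Sum>j\<in>UNIV. of_int (A $ i $ j) * (x $ j - y $ j)) \<in> \<int>" for i
    by (intro Ints_sum Ints_mult) (auto simp: lattice_rel_def)
  then show "lattice_rel (map_matrix real_of_int A *v x) (map_matrix real_of_int A *v y)"
    by (simp add: lattice_rel_def matrix_vector_mult_def sum_subtractf algebra_simps)
qed

definition cyclic_subgroup :: "('a, 'b) monoid_scheme \<Rightarrow> 'a \<Rightarrow> 'a set" where
  "cyclic_subgroup G a = {a [^]\<^bsub>G\<^esub> k |k :: int. True}"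

definition internal_direct_product ::
    "('a, 'b) monoid_scheme \<Rightarrow> 'a set \<Rightarrow> 'a set \<Rightarrow> bool" where
  "internal_direct_product G H K \<longleftrightarrow>
     H \<lhd> G \<and> K \<lhd> G \<and> H <#>\<^bsub>G\<^esub> K = carrier G \<and> H \<inter> K = {\<one>\<^bsub>G\<^esub>}"

section \<open>Diffeomorphisms of class $C^1$\<close>

text \<open>
  All tangent spaces of the torus are identified with \<open>real ^ 'n\<close> by means of the
  projection \<open>to_torus\<close>, whose local inverses are the charts. So the derivative of a map at a
  point is the matrix of the derivative of a local lift \<open>F\<close> of it. It does not depend on the choice
  of the lift: two lifts that are both differentiable (hence continuous) at \<open>x\<close> differ
  by a constant near \<open>x\<close>.
\<close>

definition has_torus_derivative ::
    "('n torus \<Rightarrow> 'n::finite torus) \<Rightarrow> real ^ 'n ^ 'n \<Rightarrow> 'n torus \<Rightarrow> bool" where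
  "has_torus_derivative f D \<theta> \<longleftrightarrow>
     (\<exists>x F. to_torus x = \<theta> \<and> (\<forall>\<^sub>F y in nhds x. to_torus (F y) = f (to_torus y)) \<and>
            (F has_derivative (*v) D) (at x))"

definition torus_deriv :: "('n torus \<Rightarrow> 'n::finite torus) \<Rightarrow> 'n torus \<Rightarrow> real ^ 'n ^ 'n" where
  "torus_deriv f \<theta> = (THE D. has_torus_derivative f D \<theta>)"

definition C1_map :: "('n torus \<Rightarrow> 'n::finite torus) \<Rightarrow> bool" where
  "C1_map f \<longleftrightarrow> (\<exists>D. (\<forall>\<theta>. has_torus_derivative f (D \<theta>) \<theta>) \<and> continuous_on UNIV D)"

definition Diff1 :: "('n torus \<Rightarrow> 'n::finite torus) monoid" where
  "Diff1 = \<lparr>carrier = {f. bij f \<and> C1_map f \<and> C1_map (inv_into UNIV f)}, mult = (\<circ>), one = id\<rparr>"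

text \<open>Uniform closeness of the maps and of their derivatives, with respect to the (entrywise) Euclidean
  norm on matrices; the torus being compact, this is the usual topology.\<close>

definition C1_ball ::
    "('n torus \<Rightarrow> 'n::finite torus) \<Rightarrow> real \<Rightarrow> ('n torus \<Rightarrow> 'n torus) set" where
  "C1_ball f e = {g \<in> carrier Diff1.
     \<forall>\<theta>. dist (f \<theta>) (g \<theta>) < e \<and> dist (torus_deriv f \<theta>) (torus_deriv g \<theta>) < e}"

definition C1_topology :: "('n torus \<Rightarrow> 'n::finite torus) topology" where
  "C1_topology =
     topology (\<lambda>V. V \<subseteq> carrier Diff1 \<and> (\<forall>f\<in>V. \<exists>e>0. C1_ball f e \<subseteq> V))"

lemma openin_C1_topology:
  "openin C1_topology V \<longleftrightarrow> V \<subseteq> carrier Diff1 \<and> (\<forall>f\<in>V. \<exists>e>0. C1_ball f e \<subseteq> V)"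
proof -
  have mono: "C1_ball f d \<subseteq> C1_ball f e" if "d \<le> e" for f :: "'a torus \<Rightarrow> 'a torus" and d e
    using that unfolding C1_ball_def by (blast intro: less_le_trans)
  have "istopology (\<lambda>V :: ('a torus \<Rightarrow> 'a torus) set.
          V \<subseteq> carrier Diff1 \<and> (\<forall>f\<in>V. \<exists>e>0. C1_ball f e \<subseteq> V))"
    unfolding istopology_def
  proof (intro conjI allI impI ballI)
    fix S T :: "('a torus \<Rightarrow> 'a torus) set" and f
    assume S: "S \<subseteq> carrier Diff1 \<and> (\<forall>f\<in>S. \<exists>e>0. C1_ball f e \<subseteq> S)"
      and T: "T \<subseteq> carrier Diff1 \<and> (\<forall>f\<in>T. \<exists>e>0. C1_ball f e \<subseteq> T)"
    show "S \<inter> T \<subseteq> carrier Diff1" using S by blast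
    assume "f \<in> S \<inter> T"
    then obtain d e where "d > 0" "e > 0" "C1_ball f d \<subseteq> S" "C1_ball f e \<subseteq> T"
      using S T by blast
    then show "\<exists>e>0. C1_ball f e \<subseteq> S \<inter> T"
      using mono[of "min d e" d f] mono[of "min d e" e f]
      by (intro exI[of _ "min d e"]) auto
  next
    fix K :: "('a torus \<Rightarrow> 'a torus) set set"
    assume K: "\<forall>V\<in>K. V \<subseteq> carrier Diff1 \<and> (\<forall>f\<in>V. \<exists>e>0. C1_ball f e \<subseteq> V)"
    then show "\<Union>K \<subseteq> carrier Diff1" by blast
    fix f assume "f \<in> \<Union>K"
    then show "\<exists>e>0. C1_ball f e \<subseteq> \<Union>K" using K by (meson Union_iff Union_upper subset_trans)
  qed
  then show ?thesis unfolding C1_topology_def by (simp add: topology_inverse')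
qed

definition centralizer_Diff1 ::
    "('n torus \<Rightarrow> 'n::finite torus) \<Rightarrow> ('n torus \<Rightarrow> 'n torus) set" where
  "centralizer_Diff1 f = {g \<in> carrier Diff1. f \<circ> g = g \<circ> f}"

text \<open>Continuity of the splitting is not required, as it follows from the uniform estimates.\<close>

definition anosov :: "('n torus \<Rightarrow> 'n::finite torus) \<Rightarrow> bool" where
  "anosov f \<longleftrightarrow> f \<in> carrier Diff1 \<and>
     (\<exists>Es Eu C r. C > 0 \<and> 0 < r \<and> r < 1 \<and>
       (\<forall>\<theta>. subspace (Es \<theta>) \<and> subspace (Eu \<theta>) \<and>
            Es \<theta> \<inter> Eu \<theta> = {0} \<and> {u + v |u v. u \<in> Es \<theta> \<and> v \<in> Eu \<theta>} = UNIV \<and>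
            (*v) (torus_deriv f \<theta>) ` Es \<theta> = Es (f \<theta>) \<and>
            (*v) (torus_deriv f \<theta>) ` Eu \<theta> = Eu (f \<theta>) \<and>
            (\<forall>k. \<forall>v\<in>Es \<theta>. norm (torus_deriv (f ^^ k) \<theta> *v v) \<le> C * r ^ k * norm v) \<and>
            (\<forall>k. \<forall>v\<in>Eu \<theta>. norm (torus_deriv (inv_into UNIV f ^^ k) \<theta> *v v) \<le> C * r ^ k * norm v)))"

section \<open>Periodic points\<close>

definition Per :: "nat \<Rightarrow> ('a \<Rightarrow> 'a) \<Rightarrow> 'a set" where
  "Per k f = {\<theta>. (f ^^ k) \<theta> = \<theta>}"

definition torus_orbit :: "('n torus \<Rightarrow> 'n::finite torus) \<Rightarrow> 'n torus \<Rightarrow> 'n torus set" where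
  "torus_orbit f \<theta> = {g \<theta> |g. g \<in> cyclic_subgroup Diff1 f}"

definition distinct_periodic_spectra :: "nat \<Rightarrow> ('n torus \<Rightarrow> 'n::finite torus) \<Rightarrow> bool" where
  "distinct_periodic_spectra k f \<longleftrightarrow>
     (\<forall>\<theta>\<in>Per k f. \<forall>\<theta>'\<in>Per k f. torus_orbit f \<theta> \<noteq> torus_orbit f \<theta>' \<longrightarrow>
        cspectrum (map_matrix of_real (torus_deriv (f ^^ k) \<theta>)) \<noteq>
        cspectrum (map_matrix of_real (torus_deriv (f ^^ k) \<theta>')))"

text \<open>The properties of the neighbourhood $\mathcal{U}(A)$ and of the conjugacies $h_f$
  provided by structural stability; \<open>e\<close> is the bound on the distance of $h_f$ to the identity.\<close>

definition structural_stability_nbhd ::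
    "int ^ 'n ^ 'n::finite \<Rightarrow> ('n torus \<Rightarrow> 'n torus) set \<Rightarrow>
     (('n torus \<Rightarrow> 'n torus) \<Rightarrow> 'n torus \<Rightarrow> 'n torus) \<Rightarrow> real \<Rightarrow> bool" where
  "structural_stability_nbhd A U h e \<longleftrightarrow>
     openin C1_topology U \<and> torus_map A \<in> U \<and>
     (\<forall>f\<in>U. anosov f \<and>
        homeomorphism UNIV UNIV (h f) (inv_into UNIV (h f)) \<and>
        h f \<circ> f \<circ> inv_into UNIV (h f) = torus_map A \<and>
        (\<forall>\<theta>. dist (h f \<theta>) \<theta> < e))"

definition distinct_spectra_set ::
    "nat \<Rightarrow> int ^ 'n ^ 'n::finite \<Rightarrow> ('n torus \<Rightarrow> 'n torus) set \<Rightarrow>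
     ('n torus \<Rightarrow> 'n torus) set \<Rightarrow> bool" where
  "distinct_spectra_set k A U V \<longleftrightarrow>
     V \<noteq> {} \<and> openin C1_topology V \<and> V \<subseteq> U - {torus_map A} \<and>
     (\<forall>f\<in>V. distinct_periodic_spectra k f)"

end

theory Submission
  imports Defs "HOL-Computational_Algebra.Fundamental_Theorem_Algebra"
begin

text \<open>
  Let \<open>g\<close> commute with \<open>f\<close>. Differentiating \<open>f \<circ> g = g \<circ> f\<close> at a fixed point \<open>\<theta>\<close> of \<open>f\<close> shows that
  the derivatives of \<open>f\<close> at \<open>\<theta>\<close> and \<open>g \<theta>\<close> are similar, so by the assumption on the spectra \<open>g\<close> fixes
  every fixed point of \<open>f\<close>. Hence the conjugate of \<open>g\<close> by \<open>h f\<close> commutes with \<open>A\<close> and fixes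
  \<open>Per 1 A\<close> pointwise, in particular 0; by a theorem of Adler and Palais it is a linear
  automorphism \<open>A^k J^m\<close>, and \<open>J^m\<close> also fixes \<open>Per 1 A\<close> pointwise. As \<open>A\<close> has infinite order, the
  involution \<open>- I\<close> is a power of \<open>J\<close>, and since \<open>J\<close> has order \<open>2^b\<close>, it would be a power of \<open>J^m\<close> if
  \<open>J^m \<noteq> I\<close>. Then \<open>Per 1 A\<close> would be contained in the finite set \<open>Per 1 (- I)\<close>, against
  the assumption on the cardinalities. So \<open>J^m = I\<close> and \<open>g = f^k\<close>.
\<close>

hide_const (open) up_ring.coeff up_ring.monom Module.smult

section \<open>Bounded orbits of hyperbolic matrices\<close>

definition poly_orbit :: "'a::field ^ 'n ^ 'n::finite \<Rightarrow> 'a poly \<Rightarrow> 'a ^ 'n \<Rightarrow> 'a ^ 'n" where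
  "poly_orbit M q v = (\<Sum>i\<le>degree q. coeff q i *s (((*v) M ^^ i) v))"

lemma poly_orbit_eq_sum:
  assumes "degree q < N"
  shows "poly_orbit M q v = (\<Sum>i<N. coeff q i *s (((*v) M ^^ i) v))"
  unfolding poly_orbit_def
  by (rule sum.mono_neutral_left) (use assms in \<open>auto simp: coeff_eq_0\<close>)

lemma poly_orbit_linear_factor:
  "poly_orbit M ([:- \<mu>, 1:] * r) v = poly_orbit M r (M *v v - \<mu> *s v)"
proof -
  define N where "N = Suc (degree r)"
  have pow_add: "((*v) M ^^ i) (x - y) = ((*v) M ^^ i) x - ((*v) M ^^ i) y" for i x y
    by (induction i) (simp_all add: matrix_vector_mult_diff_distrib)
  have pow_scale: "((*v) M ^^ i) (c *s x) = c *s ((*v) M ^^ i) x" for i c x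
    by (induction i) (simp_all add: vector_scalar_commute)
  have eq: "[:- \<mu>, 1:] * r = pCons 0 r - smult \<mu> r" by simp
  have "degree ([:- \<mu>, 1:] * r) < Suc N"
    unfolding N_def using degree_mult_le[of "[:-\<mu>, 1:]" r] by auto
  then have "poly_orbit M ([:- \<mu>, 1:] * r) v =
      (\<Sum>i<Suc N. coeff (pCons 0 r) i *s ((*v) M ^^ i) v) - (\<Sum>i<Suc N. (\<mu> * coeff r i) *s ((*v) M ^^ i) v)"
    unfolding eq by (simp add: poly_orbit_eq_sum vector_sub_rdistrib sum_subtractf del: sum.lessThan_Suc)
  also have "(\<Sum>i<Suc N. coeff (pCons 0 r) i *s ((*v) M ^^ i) v) =
      (\<Sum>i<N. coeff r i *s ((*v) M ^^ i) (M *v v))"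
    by (subst sum.lessThan_Suc_shift) (simp add: funpow_swap1)
  also have "(\<Sum>i<Suc N. (\<mu> * coeff r i) *s ((*v) M ^^ i) v) =
      (\<Sum>i<N. coeff r i *s ((*v) M ^^ i) (\<mu> *s v))"
    by (simp add: N_def coeff_eq_0 pow_scale mult.commute)
  finally show ?thesis
    by (simp add: poly_orbit_eq_sum[of r N] N_def pow_add vector_ssub_ldistrib sum_subtractf)
qed

lemma exists_annihilating_poly:
  fixes M :: "'a::field ^ 'n ^ 'n::finite"
  obtains q where "q \<noteq> 0" "poly_orbit M q v = 0"
proof -
  define w where "w i = ((*v) M ^^ i) v" for i
  define n where "n = CARD('n)"
  have "\<exists>c. (\<exists>i\<le>n. c i \<noteq> 0) \<and> (\<Sum>i\<le>n. c i *s w i) = 0"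
  proof (cases "inj_on w {..n}")
    case True
    then have card: "card (w ` {..n}) = Suc n" by (simp add: card_image)
    have "vec.dependent (w ` {..n})"
    proof (rule ccontr)
      assume "\<not> vec.dependent (w ` {..n})"
      from vec.independent_card_le_dim[OF subset_UNIV this] card
      show False unfolding vec_dim_card by (simp add: n_def)
    qed
    then obtain u where u: "\<exists>x\<in>w ` {..n}. u x \<noteq> 0" "(\<Sum>x\<in>w ` {..n}. u x *s x) = 0"
      by (auto simp: vec.dependent_finite)
    then show ?thesis
      using True by (intro exI[of _ "u \<circ> w"]) (auto simp: sum.reindex)
  next
    case False
    then obtain i j where ij: "i \<le> n" "j \<le> n" "i \<noteq> j" "w i = w j" by (auto simp: inj_on_def)
    let ?c = "\<lambda>k. if k = i then 1 else if k = j then -1 else (0::'a)"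
    have "(\<Sum>k\<le>n. ?c k *s w k) = (\<Sum>k\<le>n. (if k = i then w i else 0) - (if k = j then w j else 0))"
      using ij by (intro sum.cong) auto
    also have "\<dots> = 0" using ij by (simp add: sum_subtractf)
    finally show ?thesis using ij by (intro exI[of _ ?c]) auto
  qed
  then obtain c where c: "\<exists>i\<le>n. c i \<noteq> 0" "(\<Sum>i\<le>n. c i *s w i) = 0" by blast
  define q where "q = (\<Sum>i\<le>n. monom (c i) i)"
  have coeff: "coeff q k = (if k \<le> n then c k else 0)" for k
    by (simp add: q_def coeff_sum)
  then have "q \<noteq> 0" using c(1) by (metis coeff_0)
  moreover have "degree q < Suc n"
    using degree_le[of n q] coeff by auto
  then have "poly_orbit M q v = 0"
    using c(2) by (simp add: poly_orbit_eq_sum coeff w_def lessThan_Suc_atMost)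
  ultimately show ?thesis by (rule that)
qed

text \<open>The vectors with bounded two-sided orbit form an invariant subspace, so a nonzero one
  would yield an eigenvector with bounded two-sided orbit.\<close>

lemma bounded_orbit_eq_0:
  fixes M N :: "complex ^ 'n ^ 'n::finite"
  assumes inverse: "N ** M = mat 1" "M ** N = mat 1"
    and hyp: "\<forall>\<mu>\<in>cspectrum M. cmod \<mu> \<noteq> 1"
    and bdd: "\<And>k. norm (((*v) M ^^ k) v) \<le> C" "\<And>k. norm (((*v) N ^^ k) v) \<le> C"
  shows "v = 0"
proof -
  have main: "v = 0" if "poly_orbit M q v = 0" "q \<noteq> 0"
      "\<And>k. norm (((*v) M ^^ k) v) \<le> C" "\<And>k. norm (((*v) N ^^ k) v) \<le> C" for q v C
    using that
  proof (induction "degree q" arbitrary: q v C)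
    case 0
    then obtain a where "q = [:a:]" by (metis degree_eq_zeroE)
    with 0 show ?case by (simp add: poly_orbit_def)
  next
    case (Suc d)
    then obtain \<mu> where "poly q \<mu> = 0"
      using fundamental_theorem_of_algebra by (metis constant_degree Zero_not_Suc)
    then obtain r where q: "q = [:- \<mu>, 1:] * r" by (metis poly_eq_0_iff_dvd dvdE)
    define u where "u = M *v v - \<mu> *s v"
    have r: "r \<noteq> 0" using Suc.prems(2) q by auto
    then have "degree q = Suc (degree r)" unfolding q by (subst degree_mult_eq) simp_all
    then have "d = degree r" using Suc.hyps(2) by simp
    moreover have "poly_orbit M r u = 0"
      using Suc.prems(1) unfolding q poly_orbit_linear_factor u_def .
    moreover have commute: "M *v (N *v x) = N *v (M *v x)" for x
      using inverse by (simp add: matrix_vector_mul_assoc)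
    have Mu: "((*v) M ^^ k) u = ((*v) M ^^ Suc k) v - \<mu> *s ((*v) M ^^ k) v" for k
      by (induction k)
        (simp_all add: u_def matrix_vector_mult_diff_distrib vector_scalar_commute)
    have Nu: "((*v) N ^^ k) u = M *v ((*v) N ^^ k) v - \<mu> *s ((*v) N ^^ k) v" for k
      by (induction k)
        (simp_all add: u_def matrix_vector_mult_diff_distrib vector_scalar_commute commute)
    have norm_scale: "norm (c *s x) = cmod c * norm x" for c and x :: "complex ^ 'n"
      by (simp add: norm_vec_def L2_set_right_distrib norm_mult)
    obtain K where K: "\<And>x. norm (M *v x) \<le> norm x * K" "K \<ge> 0"
      using bounded_linear.nonneg_bounded[of "(*v) M"] matrix_vector_mul_bounded_linear by blast
    have C: "C \<ge> 0" using Suc.prems(3)[of 0] norm_ge_zero order_trans by blast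
    define C' where "C' = C + C * K + cmod \<mu> * C"
    have "norm (((*v) M ^^ k) u) \<le> C'" for k
    proof -
      have "norm (((*v) M ^^ k) u) \<le> C + cmod \<mu> * C"
        unfolding Mu by (rule order_trans[OF norm_triangle_ineq4])
          (use Suc.prems(3)[of "Suc k"] Suc.prems(3)[of k] in \<open>simp add: norm_scale add_mono mult_left_mono\<close>)
      then show ?thesis using mult_nonneg_nonneg[OF C K(2)] by (simp add: C'_def)
    qed
    moreover have "norm (((*v) N ^^ k) u) \<le> C'" for k
    proof -
      have "norm (M *v ((*v) N ^^ k) v) \<le> C * K"
        using K(1) Suc.prems(4)[of k] K(2) by (meson mult_right_mono order_trans)
      then have "norm (((*v) N ^^ k) u) \<le> C * K + cmod \<mu> * C"
        unfolding Nu by (intro order_trans[OF norm_triangle_ineq4])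
          (use Suc.prems(4)[of k] in \<open>simp add: norm_scale add_mono mult_left_mono\<close>)
      then show ?thesis using C by (simp add: C'_def)
    qed
    ultimately have "u = 0" using Suc.hyps(1) r by blast
    then have eig: "M *v v = \<mu> *s v" by (simp add: u_def)
    show ?case
    proof (rule ccontr)
      assume v: "v \<noteq> 0"
      then have "cmod \<mu> \<noteq> 1" using hyp eig by (auto simp: cspectrum_def)
      have vM: "((*v) M ^^ k) v = \<mu> ^ k *s v" for k
        by (induction k) (simp_all add: vector_scalar_commute eig vector_smult_assoc mult.commute)
      have Nv: "\<mu> *s (N *v v) = v"
        using inverse(1) eig by (metis matrix_vector_mul_assoc matrix_vector_mul_lid vector_scalar_commute)
      then have \<mu>: "\<mu> \<noteq> 0" using v by auto
      then have Nv: "N *v v = inverse \<mu> *s v"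
        using Nv by (metis left_inverse vector_smult_assoc vector_smult_lid)
      have vN: "((*v) N ^^ k) v = inverse \<mu> ^ k *s v" for k
        by (induction k) (simp_all add: vector_scalar_commute Nv vector_smult_assoc mult.commute)
      have unbounded: False if "cmod z > 1" "\<And>k. norm (z ^ k *s v) \<le> C" for z
      proof -
        obtain k where "C / norm v < cmod z ^ k" using real_arch_pow[OF \<open>cmod z > 1\<close>] by blast
        then have "C < norm (z ^ k *s v)" using v by (simp add: norm_scale norm_power field_simps)
        then show False using that(2)[of k] by simp
      qed
      show False
      proof (cases "cmod \<mu> > 1")
        case True
        then show False using unbounded[of \<mu>] Suc.prems(3) vM by simp
      next
        case False
        then have "cmod (inverse \<mu>) > 1"
          using \<open>cmod \<mu> \<noteq> 1\<close> \<mu> by (simp add: norm_inverse one_less_inverse_iff)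
        then show False using unbounded[of "inverse \<mu>"] Suc.prems(4) vN by simp
      qed
    qed
  qed
  obtain q where "q \<noteq> 0" "poly_orbit M q v = 0" by (rule exists_annihilating_poly)
  then show ?thesis using main bdd by blast
qed

abbreviation real_matrix :: "int ^ 'm ^ 'n \<Rightarrow> real ^ 'm::finite ^ 'n::finite" where
  "real_matrix \<equiv> map_matrix real_of_int"

lemma real_matrix_mult: "real_matrix (A ** B) = real_matrix A ** real_matrix B"
  by (simp add: vec_eq_iff matrix_matrix_mult_def)

lemma real_matrix_mat: "real_matrix (mat 1) = mat 1"
  by (simp add: vec_eq_iff mat_def)

lemma hyperbolic_bounded_orbit_eq_0:
  fixes A B :: "int ^ 'n ^ 'n::finite" and v :: "real ^ 'n"
  assumes "hyperbolic A" and inverse: "B ** A = mat 1" "A ** B = mat 1"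
    and bdd: "\<And>k. norm (((*v) (real_matrix A) ^^ k) v) \<le> C" "\<And>k. norm (((*v) (real_matrix B) ^^ k) v) \<le> C"
  shows "v = 0"
proof -
  let ?c = "\<lambda>v :: real ^ 'n. \<chi> i. complex_of_real (v $ i)"
  let ?m = "\<lambda>A :: int ^ 'n ^ 'n. map_matrix complex_of_int A"
  have mult: "?m M ** ?m N = ?m (M ** N)" and one: "?m (mat 1) = mat 1" for M N
    by (simp_all add: vec_eq_iff matrix_matrix_mult_def mat_def)
  have norm: "norm (?c v) = norm v" for v by (simp add: norm_vec_def)
  have "?m M *v ?c v = ?c (real_matrix M *v v)" for M v
    by (simp add: vec_eq_iff matrix_vector_mult_def)
  then have "((*v) (?m M) ^^ k) (?c v) = ?c (((*v) (real_matrix M) ^^ k) v)" for M v k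
    by (induction k) auto
  then have "?c v = 0"
    using bounded_orbit_eq_0[of "?m B" "?m A" "?c v" C] assms
    by (simp add: mult one norm hyperbolic_def)
  then show ?thesis by (simp add: vec_eq_iff)
qed

section \<open>Lifting maps of the torus\<close>

lemma eq_0_if_small_Int_vec:
  fixes x :: "real ^ 'n::finite"
  assumes "\<And>i. x $ i \<in> \<int>" "norm x < 1"
  shows "x = 0"
proof -
  have "x $ i = 0" for i
    using Ints_nonzero_abs_less1[OF assms(1)] component_le_norm_cart[of x i] assms(2) by simp
  then show ?thesis by (simp add: vec_eq_iff)
qed

lemma continuous_Int_vec_constant:
  fixes d :: "'a::real_normed_vector \<Rightarrow> real ^ 'n::finite"
  assumes "continuous_on UNIV d" "\<And>x i. d x $ i \<in> \<int>"
  shows "d x = d y"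
proof -
  have "d x $ i = d y $ i" for i
  proof -
    have "(\<lambda>x. d x $ i) constant_on UNIV"
    proof (rule continuous_discrete_range_constant)
      show "continuous_on UNIV (\<lambda>x. d x $ i)"
        using assms(1) by (intro continuous_intros)
      show "\<exists>e>0. \<forall>y. y \<in> UNIV \<and> d y $ i \<noteq> d x $ i \<longrightarrow> e \<le> norm (d y $ i - d x $ i)" for x
      proof (intro exI[of _ 1] conjI allI impI)
        fix y assume "y \<in> UNIV \<and> d y $ i \<noteq> d x $ i"
        then show "1 \<le> norm (d y $ i - d x $ i)"
          using Ints_nonzero_abs_ge1[OF Ints_diff[OF assms(2)[of y i] assms(2)[of x i]]] by simp
      qed simp
    qed (simp add: convex_connected)
    then show ?thesis by (auto simp: constant_on_def)
  qed
  then show ?thesis by (simp add: vec_eq_iff)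
qed

lemma continuous_on_to_torus: "continuous_on UNIV (to_torus :: real ^ 'n::finite \<Rightarrow> 'n torus)"
  by (metis continuous_on_open_vimage open_UNIV open_torus_iff inf_top_right)

lemma continuous_on_torus_iff:
  fixes f :: "'n::finite torus \<Rightarrow> 'a::topological_space"
  shows "continuous_on UNIV f \<longleftrightarrow> continuous_on UNIV (f \<circ> to_torus)"
  by (simp only: continuous_on_open_vimage[OF open_UNIV] open_torus_iff vimage_comp Int_UNIV_right)

lemma continuous_torus_map_lift:
  fixes \<phi> :: "'n::finite torus \<Rightarrow> 'n torus"
  assumes "continuous_on UNIV \<phi>"
  obtains \<Phi> where "continuous_on UNIV \<Phi>" "\<And>x. to_torus (\<Phi> x) = \<phi> (to_torus x)"
proof -
  define ch where "ch j \<theta> = cis (2 * pi * rep_torus \<theta> $ j)" for j :: 'n and \<theta>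
  have rep: "lattice_rel (rep_torus (to_torus x)) x" for x :: "real ^ 'n"
    by (metis Quotient_abs_rep Quotient_torus to_torus_eq_iff)
  have ch_to_torus: "ch j (to_torus x) = cis (2 * pi * x $ j)" for j x
  proof -
    from rep obtain m where "rep_torus (to_torus x) $ j - x $ j = of_int m"
      unfolding lattice_rel_def by (metis Ints_cases)
    then have "2 * pi * rep_torus (to_torus x) $ j = 2 * pi * x $ j + 2 * pi * of_int m"
      by (simp add: algebra_simps)
    then show ?thesis
      unfolding ch_def by (simp flip: cis_mult)
  qed
  have cont_ch: "continuous_on UNIV (ch j)" for j
    unfolding continuous_on_torus_iff comp_def ch_to_torus by (intro continuous_intros)
  have "\<exists>g. continuous_on UNIV g \<and> (\<forall>x. ch j (\<phi> (to_torus x)) = exp (g x))" for j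
  proof -
    have "continuous_on UNIV (\<lambda>x. ch j (\<phi> (to_torus x)))"
      by (intro continuous_on_compose2[OF cont_ch] continuous_on_compose2[OF assms]
          continuous_on_to_torus) auto
    moreover have "ch j (\<phi> (to_torus x)) \<noteq> 0" for x by (simp add: ch_def)
    ultimately show ?thesis
      using continuous_logarithm_on_contractible[OF _ convex_imp_contractible[OF convex_UNIV]]
      by (metis UNIV_I)
  qed
  then obtain g where g: "\<And>j. continuous_on UNIV (g j)"
      "\<And>j x. ch j (\<phi> (to_torus x)) = exp (g j x)" by metis
  define \<Phi> where "\<Phi> x = (\<chi> j. Im (g j x) / (2 * pi))" for x
  have "to_torus (\<Phi> x) = \<phi> (to_torus x)" for x
  proof -
    obtain y where y: "\<phi> (to_torus x) = to_torus y" by (rule to_torus_surj)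
    have "\<Phi> x $ j - y $ j \<in> \<int>" for j
    proof -
      have eq: "exp (g j x) = cis (2 * pi * y $ j)" using g(2)[of j x] y ch_to_torus by simp
      then have "norm (exp (g j x)) = 1" by simp
      then have "Re (g j x) = 0" by (simp only: norm_exp_eq_Re exp_eq_one_iff)
      then have "exp (g j x) = cis (Im (g j x))" by (simp add: exp_eq_polar)
      then have "sin (Im (g j x)) = sin (2 * pi * y $ j) \<and> cos (Im (g j x)) = cos (2 * pi * y $ j)"
        using eq by (metis cis.sel)
      then obtain m :: int where "Im (g j x) = 2 * pi * y $ j + 2 * pi * m"
        unfolding sin_cos_eq_iff by blast
      then have "\<Phi> x $ j - y $ j = of_int m" by (simp add: \<Phi>_def field_simps)
      then show ?thesis by simp
    qed
    then show ?thesis by (simp add: y to_torus_eq_iff lattice_rel_def)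
  qed
  moreover have "continuous_on UNIV \<Phi>"
    unfolding \<Phi>_def by (intro continuous_intros g) auto
  ultimately show ?thesis by (rule that[rotated])
qed

lemma additive_continuous_imp_linear:
  fixes f :: "'a::real_normed_vector \<Rightarrow> 'b::real_normed_vector"
  assumes add: "\<And>x y. f (x + y) = f x + f y" and cont: "continuous_on UNIV f"
  shows "linear f"
proof (rule linearI)
  fix r :: real and x
  interpret additive f by (unfold_locales) (rule add)
  have nat: "f (of_nat n *\<^sub>R x) = of_nat n *\<^sub>R f x" for n x
    by (induction n) (simp_all add: zero add algebra_simps)
  have int: "f (of_int m *\<^sub>R x) = of_int m *\<^sub>R f x" for m x
    by (cases m rule: int_cases2) (simp_all add: nat minus)
  have "f (q *\<^sub>R x) = q *\<^sub>R f x" if q: "q \<in> \<rat>" for q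
  proof -
    obtain a b where "b > 0" and q_eq: "q = of_int a / of_int b" using Rats_cases'[OF q] by blast
    have "of_int b *\<^sub>R f (q *\<^sub>R x) = of_int a *\<^sub>R f x"
      using \<open>b > 0\<close> by (simp add: q_eq flip: int)
    then have "(1 / of_int b) *\<^sub>R of_int b *\<^sub>R f (q *\<^sub>R x) = (1 / of_int b) *\<^sub>R of_int a *\<^sub>R f x"
      by simp
    then show ?thesis using \<open>b > 0\<close> by (simp add: q_eq)
  qed
  then have "\<forall>q\<in>\<rat>. f (q *\<^sub>R x) - q *\<^sub>R f x = 0" by simp
  moreover have "continuous_on UNIV (\<lambda>q. f (q *\<^sub>R x) - q *\<^sub>R f x)"
    by (intro continuous_intros continuous_on_compose2[OF cont]) auto
  ultimately have "f (r *\<^sub>R x) - r *\<^sub>R f x = 0"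
    using continuous_constant_on_closure[of \<rat> "\<lambda>q. f (q *\<^sub>R x) - q *\<^sub>R f x" 0 r]
    by (simp add: Rats_closure_real)
  then show "f (r *\<^sub>R x) = r *\<^sub>R f x" by simp
qed (rule add)

section \<open>Homeomorphisms commuting with a hyperbolic automorphism\<close>

lemma torus_map_to_torus: "torus_map A (to_torus x) = to_torus (real_matrix A *v x)"
  by (rule torus_map.abs_eq)

lemma torus_map_mult: "torus_map (A ** B) = torus_map A \<circ> torus_map B"
proof
  fix \<theta> :: "'a torus"
  obtain x where "\<theta> = to_torus x" by (rule to_torus_surj)
  then show "torus_map (A ** B) \<theta> = (torus_map A \<circ> torus_map B) \<theta>"
    by (simp add: torus_map_to_torus real_matrix_mult matrix_vector_mul_assoc)
qed

lemma torus_map_mat_1: "torus_map (mat 1) = id"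
proof
  fix \<theta> :: "'a torus"
  obtain x where "\<theta> = to_torus x" by (rule to_torus_surj)
  then show "torus_map (mat 1) \<theta> = id \<theta>"
    by (simp add: torus_map_to_torus real_matrix_mat)
qed

lemma inj_torus_map: "torus_map A = torus_map B \<Longrightarrow> A = B"
proof (rule ccontr)
  assume eq: "torus_map A = torus_map B" and "A \<noteq> B"
  then obtain i j where ij: "A $ i $ j \<noteq> B $ i $ j" by (auto simp: vec_eq_iff)
  define d where "d = real_of_int (A $ i $ j - B $ i $ j)"
  have "d \<noteq> 0" using ij by (simp add: d_def)
  define x :: "real ^ 'a" where "x = axis j (1 / (2 * d))"
  have comp: "(real_matrix M *v x) $ i = of_int (M $ i $ j) / (2 * d)" for M :: "int ^ 'a ^ 'a"
  proof -
    have "(real_matrix M *v x) $ i = (\<Sum>k\<in>UNIV. if k = j then of_int (M $ i $ j) / (2 * d) else 0)"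
      unfolding matrix_vector_mult_def x_def vec_lambda_beta by (intro sum.cong) (auto simp: axis_def)
    then show ?thesis by simp
  qed
  have "to_torus (real_matrix A *v x) = to_torus (real_matrix B *v x)"
    using eq by (simp flip: torus_map_to_torus)
  then have "(real_matrix A *v x) $ i - (real_matrix B *v x) $ i \<in> \<int>"
    by (simp add: to_torus_eq_iff lattice_rel_def)
  moreover have "real_of_int (A $ i $ j) = real_of_int (B $ i $ j) + d"
    by (simp add: d_def)
  then have "(real_matrix A *v x) $ i - (real_matrix B *v x) $ i = 1 / 2"
    using \<open>d \<noteq> 0\<close> by (simp add: comp add_divide_distrib)
  ultimately show False
    using Ints_nonzero_abs_ge1[of "1 / 2 :: real"] by simp
qed

text \<open>The additivity defect of a lift is biperiodic, hence bounded, and it commutes with \<open>A\<close>.\<close>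

lemma commuting_with_hyperbolic_imp_torus_map:
  fixes A A' :: "int ^ 'n ^ 'n::finite"
  assumes hyp: "hyperbolic A" and inverse: "A' ** A = mat 1" "A ** A' = mat 1"
    and cont: "continuous_on UNIV \<phi>"
    and commute: "\<phi> \<circ> torus_map A = torus_map A \<circ> \<phi>"
    and fix0: "\<phi> (to_torus 0) = to_torus 0"
  obtains B where "\<phi> = torus_map B"
proof -
  define R where "R = real_matrix A"
  define R' where "R' = real_matrix A'"
  have RR': "R *v (R' *v x) = x" "R' *v (R *v x) = x" for x
    using inverse by (simp_all add: R_def R'_def matrix_vector_mul_assoc real_matrix_mat flip: real_matrix_mult)
  have to_torus_eqD: "x $ i - y $ i \<in> \<int>" if "to_torus x = to_torus y" for x y :: "real ^ 'n" and i
    using that by (simp add: to_torus_eq_iff lattice_rel_def)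
  have to_torus_eqI: "to_torus x = to_torus y" if "\<And>i. x $ i - y $ i \<in> \<int>" for x y :: "real ^ 'n"
    using that by (simp add: to_torus_eq_iff lattice_rel_def)
  obtain \<Phi>0 where \<Phi>0: "continuous_on UNIV \<Phi>0" "\<And>x. to_torus (\<Phi>0 x) = \<phi> (to_torus x)"
    using continuous_torus_map_lift[OF cont] by blast
  define \<Phi> where "\<Phi> x = \<Phi>0 x - \<Phi>0 0" for x
  have cont\<Phi>: "continuous_on UNIV \<Phi>"
    unfolding \<Phi>_def by (intro continuous_intros \<Phi>0)
  have "to_torus (\<Phi>0 0) = to_torus 0" using \<Phi>0(2)[of 0] fix0 by simp
  then have "\<Phi>0 0 $ i \<in> \<int>" for i using to_torus_eqD[of "\<Phi>0 0" 0 i] by simp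
  then have lift: "to_torus (\<Phi> x) = \<phi> (to_torus x)" for x
    unfolding \<Phi>_def \<Phi>0(2)[symmetric] by (intro to_torus_eqI) (simp add: Ints_minus)
  have \<Phi>_0: "\<Phi> 0 = 0" by (simp add: \<Phi>_def)
  have \<Phi>R: "\<Phi> (R *v x) = R *v \<Phi> x" for x
  proof -
    have "continuous_on UNIV (\<lambda>x. \<Phi> (R *v x) - R *v \<Phi> x)"
      by (intro continuous_intros continuous_on_compose2[OF cont\<Phi>]
          continuous_on_compose2[OF matrix_vector_mult_linear_continuous_on] cont\<Phi>) auto
    moreover have "(\<Phi> (R *v x) - R *v \<Phi> x) $ i \<in> \<int>" for x i
      unfolding vector_minus_component
    proof (rule to_torus_eqD)
      have "to_torus (R *v \<Phi> x) = (torus_map A \<circ> \<phi>) (to_torus x)"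
        by (simp add: R_def lift flip: torus_map_to_torus)
      also have "\<dots> = to_torus (\<Phi> (R *v x))"
        unfolding commute[symmetric] by (simp add: lift torus_map_to_torus R_def)
      finally show "to_torus (\<Phi> (R *v x)) = to_torus (R *v \<Phi> x)" ..
    qed
    ultimately have "\<Phi> (R *v x) - R *v \<Phi> x = \<Phi> (R *v 0) - R *v \<Phi> 0"
      by (rule continuous_Int_vec_constant)
    then show ?thesis by (simp add: \<Phi>_0)
  qed
  have \<Phi>_period: "\<Phi> (x + m) = \<Phi> x + \<Phi> m" if m: "\<And>i. m $ i \<in> \<int>" for x m
  proof -
    have "continuous_on UNIV (\<lambda>x. \<Phi> (x + m) - \<Phi> x)"
      by (intro continuous_intros continuous_on_compose2[OF cont\<Phi>] cont\<Phi>) auto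
    moreover have "(\<Phi> (x + m) - \<Phi> x) $ i \<in> \<int>" for x i
      unfolding vector_minus_component
      by (rule to_torus_eqD) (unfold lift, rule arg_cong[of _ _ \<phi>], rule to_torus_eqI, simp add: m)
    ultimately have "\<Phi> (x + m) - \<Phi> x = \<Phi> (0 + m) - \<Phi> 0"
      by (rule continuous_Int_vec_constant)
    then show ?thesis by (simp add: \<Phi>_0 algebra_simps)
  qed
  have \<Phi>R': "\<Phi> (R' *v x) = R' *v \<Phi> x" for x
    using arg_cong[OF \<Phi>R[of "R' *v x"], of "(*v) R'"] by (simp add: RR')
  define w where "w x y = \<Phi> (x + y) - \<Phi> x - \<Phi> y" for x y
  have w_period1: "w (x + m) y = w x y" if "\<And>i. m $ i \<in> \<int>" for x y m
    using \<Phi>_period[OF that, of "x + y"] \<Phi>_period[OF that, of x] by (simp add: w_def algebra_simps)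
  have w_sym: "w x y = w y x" for x y by (simp add: w_def add.commute)
  have w_period2: "w x (y + m) = w x y" if "\<And>i. m $ i \<in> \<int>" for x y m
    using w_period1[OF that, of y x] by (simp only: w_sym[of x])
  have "compact (cbox (0 :: real ^ 'n) 1 \<times> cbox (0 :: real ^ 'n) 1)"
    by (intro compact_Times compact_cbox)
  moreover have "continuous_on (cbox (0 :: real ^ 'n) 1 \<times> cbox (0 :: real ^ 'n) 1) (\<lambda>(x, y). w x y)"
    unfolding w_def split_def by (intro continuous_intros continuous_on_compose2[OF cont\<Phi>]) auto
  ultimately have "bounded ((\<lambda>(x, y). w x y) ` (cbox 0 1 \<times> cbox 0 1))"
    by (intro compact_imp_bounded compact_continuous_image)
  then obtain C where C: "\<And>x y. x \<in> cbox 0 1 \<Longrightarrow> y \<in> cbox 0 1 \<Longrightarrow> norm (w x y) \<le> C"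
    unfolding bounded_iff by auto
  have w_bdd: "norm (w x y) \<le> C" for x y
  proof -
    define fl :: "real ^ 'n \<Rightarrow> real ^ 'n" where "fl x = (\<chi> i. - of_int \<lfloor>x $ i\<rfloor>)" for x
    have fl: "fl x $ i \<in> \<int>" for x i by (simp add: fl_def Ints_minus)
    have box: "x + fl x \<in> cbox 0 1" for x
    proof -
      have "x $ i - of_int \<lfloor>x $ i\<rfloor> \<ge> 0 \<and> x $ i - of_int \<lfloor>x $ i\<rfloor> \<le> 1" for i
        using floor_correct[of "x $ i"] by linarith
      then show ?thesis unfolding mem_box_cart by (simp add: fl_def)
    qed
    have "w x y = w (x + fl x) (y + fl y)" by (simp add: w_period1 w_period2 fl)
    then show ?thesis using C box by simp
  qed
  have wR_step: "R *v w x y = w (R *v x) (R *v y)" for x y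
    by (simp only: w_def \<Phi>R[symmetric] matrix_vector_right_distrib matrix_vector_mult_diff_distrib)
  have wR: "((*v) R ^^ k) (w x y) = w (((*v) R ^^ k) x) (((*v) R ^^ k) y)" for k x y
    by (induction k) (simp_all add: wR_step)
  have wR'_step: "R' *v w x y = w (R' *v x) (R' *v y)" for x y
    by (simp only: w_def \<Phi>R'[symmetric] matrix_vector_right_distrib matrix_vector_mult_diff_distrib)
  have wR': "((*v) R' ^^ k) (w x y) = w (((*v) R' ^^ k) x) (((*v) R' ^^ k) y)" for k x y
    by (induction k) (simp_all add: wR'_step)
  have "w x y = 0" for x y
    by (rule hyperbolic_bounded_orbit_eq_0[OF hyp inverse, where C = C])
      (simp_all only: wR wR' w_bdd flip: R_def R'_def)
  then have "\<Phi> (x + y) = \<Phi> x + \<Phi> y" for x y by (simp add: w_def algebra_simps)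
  then have "linear \<Phi>" using cont\<Phi> by (rule additive_continuous_imp_linear)
  have int: "\<Phi> (axis j 1) $ i \<in> \<int>" for i j
  proof -
    have "to_torus (axis j 1) = to_torus (0 :: real ^ 'n)"
      by (intro to_torus_eqI) (simp add: axis_def)
    then have "to_torus (\<Phi> (axis j 1)) = to_torus 0" using fix0 by (simp add: lift)
    then show ?thesis using to_torus_eqD by fastforce
  qed
  define B :: "int ^ 'n ^ 'n" where "B = (\<chi> i j. \<lfloor>\<Phi> (axis j 1) $ i\<rfloor>)"
  have "real_matrix B = matrix \<Phi>"
    using int by (simp add: vec_eq_iff B_def matrix_def)
  then have "real_matrix B *v x = \<Phi> x" for x
    using \<open>linear \<Phi>\<close> by (simp add: matrix_works)
  then have B: "torus_map B (to_torus x) = \<phi> (to_torus x)" for x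
    by (simp add: torus_map_to_torus lift)
  have "\<phi> = torus_map B"
  proof
    fix \<theta> :: "'n torus"
    obtain x where "\<theta> = to_torus x" by (rule to_torus_surj)
    then show "\<phi> \<theta> = torus_map B \<theta>" by (simp add: B)
  qed
  then show ?thesis by (rule that)
qed

section \<open>The group of integer matrices with determinant $\pm 1$\<close>

lemma det_real_matrix: "det (real_matrix A) = of_int (det A)"
  by (simp add: det_def)

lemma GLZ_inverse_exists:
  assumes "A \<in> carrier GLZ"
  shows "\<exists>B\<in>carrier GLZ. B ** A = mat 1"
proof -
  have detA: "det A * det A = 1" using assms by (auto simp: GLZ_def)
  define R where "R = real_matrix A"
  have detR: "det R * det R = 1" unfolding R_def det_real_matrix using detA by (metis of_int_1 of_int_mult)
  then have "invertible R" by (auto simp: invertible_det_nz)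
  then obtain S where S: "R ** S = mat 1" "S ** R = mat 1" unfolding invertible_def by blast
  have "S $ k $ j \<in> \<int>" for k j
  proof -
    define x where "x = column j S"
    have Rx: "R *v x = axis j 1"
    proof -
      have "R *v x = column j (R ** S)"
        by (simp add: x_def vec_eq_iff column_def matrix_matrix_mult_def matrix_vector_mult_def)
      then show ?thesis by (simp add: S vec_eq_iff column_def mat_def axis_def)
    qed
    have "x $ k * det R = det (\<chi> i l. if l = k then (R *v x) $ i else R $ i $ l)"
      by (simp add: cramer_lemma)
    also have "\<dots> = det (real_matrix (\<chi> i l. if l = k then axis j 1 $ i else A $ i $ l))"
      unfolding Rx by (rule arg_cong[of _ _ det]) (simp add: vec_eq_iff R_def axis_def)
    finally have "x $ k * det R \<in> \<int>" by (simp add: det_real_matrix)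
    moreover have "det R \<in> \<int>" by (simp add: R_def det_real_matrix)
    ultimately have "x $ k * det R * det R \<in> \<int>" by (rule Ints_mult)
    then show ?thesis using detR by (simp add: mult.assoc x_def column_def)
  qed
  then have "S = real_matrix (\<chi> i j. \<lfloor>S $ i $ j\<rfloor>)" by (simp add: vec_eq_iff)
  then obtain B where B: "S = real_matrix B" by blast
  have "real_matrix (B ** A) = real_matrix (mat 1)"
    using S(2) by (simp add: real_matrix_mult real_matrix_mat B R_def)
  then have BA: "B ** A = mat 1" by (simp add: vec_eq_iff)
  then have "det B * det A = 1" by (metis det_mul det_I)
  then have "B \<in> carrier GLZ" by (auto simp: GLZ_def zmult_eq_1_iff)
  with BA show ?thesis by blast
qed

lemma group_GLZ: "group GLZ"
proof (rule groupI)
  show "x \<otimes>\<^bsub>GLZ\<^esub> y \<in> carrier GLZ" if "x \<in> carrier GLZ" "y \<in> carrier GLZ"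
    for x y :: "int ^ 'n ^ 'n"
    using that by (auto simp: GLZ_def det_mul)
  show "\<exists>y\<in>carrier GLZ. y \<otimes>\<^bsub>GLZ\<^esub> x = \<one>\<^bsub>GLZ\<^esub>" if "x \<in> carrier GLZ" for x :: "int ^ 'n ^ 'n"
    using GLZ_inverse_exists[OF that] by (simp add: GLZ_def)
qed (auto simp: GLZ_def matrix_mul_assoc)

lemma GLZ_simps [simp]: "A \<otimes>\<^bsub>GLZ\<^esub> B = A ** B" "\<one>\<^bsub>GLZ\<^esub> = mat 1"
  by (simp_all add: GLZ_def)

lemma mem_GLZ_if_right_inverse: "A ** B = mat 1 \<Longrightarrow> A \<in> carrier GLZ"
proof -
  assume "A ** B = mat 1"
  then have "det A * det B = 1" by (metis det_mul det_I)
  then show ?thesis by (auto simp: GLZ_def zmult_eq_1_iff)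
qed

lemma hyperbolic_pow_eq_1_iff:
  fixes A :: "int ^ 'n ^ 'n::finite"
  assumes A: "A \<in> carrier GLZ" and "hyperbolic A"
  shows "A [^]\<^bsub>GLZ\<^esub> (k :: int) = mat 1 \<longleftrightarrow> k = 0"
proof
  interpret G: group "GLZ :: (int ^ 'n ^ 'n) monoid" by (rule group_GLZ)
  assume k: "A [^]\<^bsub>GLZ\<^esub> k = mat 1"
  show "k = 0"
  proof (rule ccontr)
    assume "k \<noteq> 0"
    define v :: "real ^ 'n" where "v = 1"
    define B where "B = inv\<^bsub>GLZ\<^esub> A"
    have B: "B \<in> carrier GLZ" "B ** A = mat 1" "A ** B = mat 1"
      using A G.l_inv[OF A] G.r_inv[OF A] by (simp_all add: B_def)
    define w where "w j = real_matrix (A [^]\<^bsub>GLZ\<^esub> (j :: int)) *v v" for j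
    have "w j = w (j mod k)" for j
    proof -
      have "A [^]\<^bsub>GLZ\<^esub> j = A [^]\<^bsub>GLZ\<^esub> (k * (j div k) + j mod k)" by simp
      also have "\<dots> = (A [^]\<^bsub>GLZ\<^esub> k) [^]\<^bsub>GLZ\<^esub> (j div k) \<otimes>\<^bsub>GLZ\<^esub> A [^]\<^bsub>GLZ\<^esub> (j mod k)"
        by (simp only: G.int_pow_mult[OF A] G.int_pow_pow[OF A])
      also have "\<dots> = A [^]\<^bsub>GLZ\<^esub> (j mod k)"
        using G.int_pow_one[of "j div k"] by (simp add: k)
      finally show ?thesis by (simp add: w_def)
    qed
    moreover have "j mod k \<in> {- \<bar>k\<bar>..\<bar>k\<bar>}" for j
      using abs_mod_less[OF \<open>k \<noteq> 0\<close>, of j] unfolding atLeastAtMost_iff by linarith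
    ultimately have "range w \<subseteq> w ` {- \<bar>k\<bar>..\<bar>k\<bar>}" by blast
    then have "finite (range w)" by (rule finite_subset) simp
    then have "bounded (range w)" by (rule finite_imp_bounded)
    then obtain C where "\<forall>x\<in>range w. norm x \<le> C" unfolding bounded_iff by blast
    then have C: "norm (w j) \<le> C" for j by simp
    have orbit: "((*v) (real_matrix M) ^^ i) v = real_matrix (M [^]\<^bsub>GLZ\<^esub> i) *v v"
      if "M \<in> carrier GLZ" for M i
      using G.nat_pow_Suc2[OF that]
      by (induction i) (simp_all add: real_matrix_mat real_matrix_mult matrix_vector_mul_assoc)
    have "v = 0"
    proof (rule hyperbolic_bounded_orbit_eq_0[OF \<open>hyperbolic A\<close> B(2,3)])
      show "norm (((*v) (real_matrix A) ^^ i) v) \<le> C" for i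
        using C[of "int i"] by (simp add: orbit[OF A] w_def int_pow_int)
      show "norm (((*v) (real_matrix B) ^^ i) v) \<le> C" for i
        using C[of "- int i"] unfolding orbit[OF B(1)] by (simp add: w_def G.int_pow_neg_int[OF A] B_def G.nat_pow_inv[OF A])
    qed
    then show False by (simp add: v_def vec_eq_iff)
  qed
qed simp

lemma (in group) involution_in_nontrivial_powers:
  assumes J: "J \<in> carrier G" and ord: "ord J = 2 ^ b"
    and m: "J [^] (m :: int) \<noteq> \<one>"
    and l: "J [^] (l :: int) \<otimes> J [^] l = \<one>"
  obtains t :: int where "(J [^] m) [^] t = J [^] l"
proof -
  let ?N = "2 ^ b :: int"
  have id: "J [^] i = \<one> \<longleftrightarrow> ?N dvd i" for i :: int
    using int_pow_eq_id[OF J, of i] ord by simp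
  have l2: "?N dvd 2 * l"
    using l by (simp add: id flip: int_pow_mult[OF J] mult_2)
  have "gcd m ?N dvd ?N" by simp
  then obtain s where s: "s \<le> b" "gcd m ?N = 2 ^ s"
    using divides_primepow[of "2::int" "gcd m ?N" b] by auto
  have "s \<noteq> b" using m id s by (metis gcd_dvd1)
  then obtain b' where b: "b = Suc b'" "s \<le> b'" using s(1) by (cases b) auto
  then have "2 ^ b' dvd l" using l2 by simp
  then have "gcd m ?N dvd l" using s b by (metis dvd_trans le_imp_power_dvd)
  then obtain c where c: "l = gcd m ?N * c" by blast
  obtain u v where uv: "u * m + v * ?N = gcd m ?N" using bezout_int by blast
  have "l - m * (u * c) = ?N * (v * c)" unfolding c uv[symmetric] by (simp add: algebra_simps)
  then have "J [^] (m * (u * c)) = J [^] l"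
    unfolding int_pow_eq[OF J] ord by simp
  then have "(J [^] m) [^] (u * c) = J [^] l" by (simp add: int_pow_pow[OF J])
  then show ?thesis by (rule that)
qed

section \<open>The group of diffeomorphisms\<close>

lemma has_torus_derivative_at:
  assumes "has_torus_derivative f D \<theta>" "to_torus x = \<theta>"
  obtains F where "\<forall>\<^sub>F y in nhds x. to_torus (F y) = f (to_torus y)" "(F has_derivative (*v) D) (at x)"
proof -
  obtain x' F where F: "to_torus x' = \<theta>" "\<forall>\<^sub>F y in nhds x'. to_torus (F y) = f (to_torus y)"
      "(F has_derivative (*v) D) (at x')"
    using assms(1) unfolding has_torus_derivative_def by blast
  have shift: "to_torus (y + (x' - x)) = to_torus y" for y
    using F(1) assms(2) to_torus_eq_iff[of x' x] by (simp add: to_torus_eq_iff lattice_rel_def)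
  have "((\<lambda>y. y + (x' - x)) \<longlongrightarrow> x + (x' - x)) (nhds x)"
    by (intro tendsto_intros filterlim_ident)
  then have "filterlim (\<lambda>y. y + (x' - x)) (nhds x') (nhds x)" by simp
  then have "\<forall>\<^sub>F y in nhds x. to_torus (F (y + (x' - x))) = f (to_torus (y + (x' - x)))"
    using F(2) by (rule eventually_compose_filterlim[rotated])
  moreover have "((\<lambda>y. F (y + (x' - x))) has_derivative (*v) D) (at x)"
    by (rule has_derivative_compose[of "\<lambda>y. y + (x' - x)" "\<lambda>y. y" x UNIV F "(*v) D"])
      (use F(3) in \<open>auto intro!: derivative_eq_intros\<close>)
  ultimately show ?thesis using that by (simp add: shift)
qed

lemma has_torus_derivative_unique:
  assumes "has_torus_derivative f D \<theta>" "has_torus_derivative f E \<theta>"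
  shows "D = E"
proof -
  obtain x where x: "\<theta> = to_torus x" by (rule to_torus_surj)
  obtain F where F: "\<forall>\<^sub>F y in nhds x. to_torus (F y) = f (to_torus y)"
      "(F has_derivative (*v) D) (at x)"
    using has_torus_derivative_at[OF assms(1) x[symmetric]] by blast
  obtain G where G: "\<forall>\<^sub>F y in nhds x. to_torus (G y) = f (to_torus y)"
      "(G has_derivative (*v) E) (at x)"
    using has_torus_derivative_at[OF assms(2) x[symmetric]] by blast
  define d where "d y = F y - G y" for y
  have int: "\<forall>\<^sub>F y in nhds x. \<forall>i. d y $ i \<in> \<int>"
    using F(1) G(1)
  proof eventually_elim
    case (elim y)
    then have "to_torus (F y) = to_torus (G y)" by simp
    then show ?case by (simp add: to_torus_eq_iff lattice_rel_def d_def)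
  qed
  have d: "(d has_derivative (\<lambda>v. D *v v - E *v v)) (at x)"
    unfolding d_def by (intro has_derivative_diff F G)
  then have "isCont d x" by (rule has_derivative_continuous)
  then have "(d \<longlongrightarrow> d x) (nhds x)" by (simp add: continuous_at tendsto_nhds_iff)
  then have "\<forall>\<^sub>F y in nhds x. dist (d y) (d x) < 1" by (rule tendstoD) simp
  then have "\<forall>\<^sub>F y in nhds x. d y = d x"
    using int
  proof eventually_elim
    case (elim y)
    have "d x $ i \<in> \<int>" for i using eventually_nhds_x_imp_x[OF int] by simp
    then have "d y - d x = 0"
      using elim by (intro eq_0_if_small_Int_vec) (auto simp: dist_norm)
    then show ?case by simp
  qed
  then have "(d has_derivative (\<lambda>v. 0)) (at x)"
    by (intro has_derivative_transform_eventually[OF has_derivative_const[of "d x"]])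
      (auto simp: eventually_at_filter elim: eventually_mono)
  with d have "(\<lambda>v. D *v v - E *v v) = (\<lambda>v. 0)" by (rule has_derivative_unique)
  then have "D *v v = E *v v" for v by (metis eq_iff_diff_eq_0)
  then show ?thesis by (simp add: matrix_eq)
qed

lemma has_torus_derivative_compose:
  assumes f: "has_torus_derivative f D \<theta>" and g: "has_torus_derivative g E (f \<theta>)"
  shows "has_torus_derivative (g \<circ> f) (E ** D) \<theta>"
proof -
  obtain x where x: "\<theta> = to_torus x" by (rule to_torus_surj)
  obtain F where F: "\<forall>\<^sub>F y in nhds x. to_torus (F y) = f (to_torus y)"
      "(F has_derivative (*v) D) (at x)"
    using has_torus_derivative_at[OF f x[symmetric]] by blast
  have "to_torus (F x) = f \<theta>" using eventually_nhds_x_imp_x[OF F(1)] x by simp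
  then obtain G where G: "\<forall>\<^sub>F y in nhds (F x). to_torus (G y) = g (to_torus y)"
      "(G has_derivative (*v) E) (at (F x))"
    using has_torus_derivative_at[OF g] by blast
  have "(F \<longlongrightarrow> F x) (nhds x)"
    using has_derivative_continuous[OF F(2)] by (simp add: continuous_at tendsto_nhds_iff)
  then have "\<forall>\<^sub>F y in nhds x. to_torus (G (F y)) = g (to_torus (F y))"
    using G(1) by (rule eventually_compose_filterlim[rotated])
  then have "\<forall>\<^sub>F y in nhds x. to_torus (G (F y)) = (g \<circ> f) (to_torus y)"
    using F(1) by eventually_elim simp
  moreover have "((\<lambda>y. G (F y)) has_derivative (*v) (E ** D)) (at x)"
    using has_derivative_compose[OF F(2) G(2)] by (simp add: matrix_vector_mul_assoc)
  ultimately show ?thesis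
    unfolding has_torus_derivative_def x by (intro exI[of _ x] exI[of _ "\<lambda>y. G (F y)"]) simp
qed

lemma has_torus_derivative_id: "has_torus_derivative id (mat 1) \<theta>"
proof -
  obtain x where "\<theta> = to_torus x" by (rule to_torus_surj)
  then show ?thesis
    unfolding has_torus_derivative_def
    by (intro exI[of _ x] exI[of _ "\<lambda>y. y"]) (simp add: matrix_vector_mul_lid[abs_def])
qed

lemma torus_deriv_eq: "has_torus_derivative f D \<theta> \<Longrightarrow> torus_deriv f \<theta> = D"
  unfolding torus_deriv_def using has_torus_derivative_unique by blast

lemma C1_map_has_torus_derivative:
  "C1_map f \<Longrightarrow> has_torus_derivative f (torus_deriv f \<theta>) \<theta>"
  unfolding C1_map_def using torus_deriv_eq by metis

lemma C1_map_imp_continuous: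
  fixes f :: "'n torus \<Rightarrow> 'n::finite torus"
  assumes "C1_map f"
  shows "continuous_on UNIV f"
  unfolding continuous_on_iff
proof (intro ballI allI impI)
  fix \<theta> :: "'n torus" and e :: real assume "e > 0"
  obtain x where x: "to_torus x = \<theta>" by (metis to_torus_surj)
  obtain F where F: "\<forall>\<^sub>F y in nhds x. to_torus (F y) = f (to_torus y)"
      "(F has_derivative (*v) (torus_deriv f \<theta>)) (at x)"
    using has_torus_derivative_at[OF C1_map_has_torus_derivative[OF assms] x] by blast
  have "(F \<longlongrightarrow> F x) (nhds x)"
    using has_derivative_continuous[OF F(2)] by (simp add: continuous_at tendsto_nhds_iff)
  then have "\<forall>\<^sub>F y in nhds x. dist (F y) (F x) < e" using \<open>e > 0\<close> by (rule tendstoD)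
  then have "\<forall>\<^sub>F y in nhds x. dist (f (to_torus y)) (f \<theta>) < e"
    using F(1)
  proof eventually_elim
    case (elim y)
    have "to_torus (F x) = f \<theta>" using eventually_nhds_x_imp_x[OF F(1)] x by simp
    then show ?case using elim torus_dist_le[of "F y" _ "F x"] by (fastforce simp: dist_norm)
  qed
  then obtain d where d: "d > 0" "\<And>y. dist y x < d \<Longrightarrow> dist (f (to_torus y)) (f \<theta>) < e"
    unfolding eventually_nhds_metric by blast
  have "dist (f \<theta>') (f \<theta>) < e" if "dist \<theta>' \<theta> < d" for \<theta>'
  proof -
    from that obtain y where "to_torus y = \<theta>'" "norm (x - y) < d"
      using torus_dist_lessD[of \<theta> \<theta>' d x] x by (auto simp: dist_commute)
    then show ?thesis using d(2)[of y] by (auto simp: dist_norm norm_minus_commute)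
  qed
  then show "\<exists>d>0. \<forall>\<theta>'\<in>UNIV. dist \<theta>' \<theta> < d \<longrightarrow> dist (f \<theta>') (f \<theta>) < e"
    using d(1) by blast
qed

lemma C1_map_compose:
  assumes "C1_map f" "C1_map g"
  shows "C1_map (g \<circ> f)"
proof -
  obtain D where D: "\<And>\<theta>. has_torus_derivative f (D \<theta>) \<theta>" "continuous_on UNIV D"
    using assms(1) unfolding C1_map_def by blast
  obtain E where E: "\<And>\<theta>. has_torus_derivative g (E \<theta>) \<theta>" "continuous_on UNIV E"
    using assms(2) unfolding C1_map_def by blast
  have "continuous_on UNIV (\<lambda>\<theta>. E (f \<theta>))"
    by (rule continuous_on_compose2[OF E(2) C1_map_imp_continuous[OF assms(1)]]) simp
  then have "continuous_on UNIV (\<lambda>\<theta>. E (f \<theta>) ** D \<theta>)"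
    unfolding matrix_matrix_mult_def by (intro continuous_intros D)
  then show ?thesis
    unfolding C1_map_def using has_torus_derivative_compose[OF D(1) E(1)]
    by (intro exI[of _ "\<lambda>\<theta>. E (f \<theta>) ** D \<theta>"]) auto
qed

lemma group_Diff1: "group (Diff1 :: ('n torus \<Rightarrow> 'n::finite torus) monoid)"
proof (rule groupI)
  show "f \<otimes>\<^bsub>Diff1\<^esub> g \<in> carrier Diff1" if "f \<in> carrier Diff1" "g \<in> carrier Diff1"
    for f g :: "'n torus \<Rightarrow> 'n torus"
    using that by (auto simp: Diff1_def bij_comp o_inv_distrib C1_map_compose)
  show "\<one>\<^bsub>Diff1\<^esub> \<in> carrier Diff1"
    unfolding Diff1_def C1_map_def
    by (auto intro!: exI[of _ "\<lambda>_. mat 1"] has_torus_derivative_id simp: inv_id)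
  show "\<exists>g\<in>carrier Diff1. g \<otimes>\<^bsub>Diff1\<^esub> f = \<one>\<^bsub>Diff1\<^esub>" if "f \<in> carrier Diff1"
    for f :: "'n torus \<Rightarrow> 'n torus"
    using that by (intro bexI[of _ "inv_into UNIV f"])
      (auto simp: Diff1_def bij_imp_bij_inv inv_inv_eq bij_is_inj)
qed (auto simp: Diff1_def comp_assoc)

lemma Diff1_simps [simp]: "f \<otimes>\<^bsub>Diff1\<^esub> g = f \<circ> g" "\<one>\<^bsub>Diff1\<^esub> = id"
  by (simp_all add: Diff1_def)

section \<open>The discrete centralizer\<close>

lemma (in group) subgroup_commuting:
  assumes x: "x \<in> carrier G"
  shows "subgroup {g \<in> carrier G. x \<otimes> g = g \<otimes> x} G"
proof (rule subgroupI)
  fix g assume g: "g \<in> {g \<in> carrier G. x \<otimes> g = g \<otimes> x}"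
  then have carrier: "g \<in> carrier G" by simp
  have "inv g \<otimes> (x \<otimes> g) \<otimes> inv g = inv g \<otimes> x"
    using carrier x by (simp add: m_assoc)
  moreover have "inv g \<otimes> (g \<otimes> x) \<otimes> inv g = x \<otimes> inv g"
    using carrier x by (simp flip: m_assoc)
  ultimately show "inv g \<in> {g \<in> carrier G. x \<otimes> g = g \<otimes> x}"
    using g by simp
next
  fix g k assume gk: "g \<in> {g \<in> carrier G. x \<otimes> g = g \<otimes> x}" "k \<in> {g \<in> carrier G. x \<otimes> g = g \<otimes> x}"
  then have carrier: "g \<in> carrier G" "k \<in> carrier G" and comm: "x \<otimes> g = g \<otimes> x" "x \<otimes> k = k \<otimes> x"
    by auto
  have "x \<otimes> (g \<otimes> k) = x \<otimes> g \<otimes> k" using carrier x by (simp add: m_assoc)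
  also have "\<dots> = g \<otimes> (x \<otimes> k)" unfolding comm(1) using carrier x by (simp add: m_assoc)
  also have "\<dots> = g \<otimes> k \<otimes> x" unfolding comm(2) using carrier x by (simp add: m_assoc)
  finally show "g \<otimes> k \<in> {g \<in> carrier G. x \<otimes> g = g \<otimes> x}" using gk by simp
qed (use x in auto)

lemma (in group) subgroup_pointwise_stabilizer:
  assumes mult: "\<And>a b. a \<in> carrier G \<Longrightarrow> b \<in> carrier G \<Longrightarrow> act (a \<otimes> b) = act a \<circ> act b"
    and one: "act \<one> = id"
  shows "subgroup {g \<in> carrier G. \<forall>p\<in>P. act g p = p} G"
proof (rule subgroupI)
  fix g assume g: "g \<in> {g \<in> carrier G. \<forall>p\<in>P. act g p = p}"
  have "act (inv g) p = p" if "p \<in> P" for p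
  proof -
    have "act (inv g) (act g p) = p"
      using g mult[of "inv g" g] one by (simp add: fun_eq_iff)
    then show ?thesis using g that by simp
  qed
  then show "inv g \<in> {g \<in> carrier G. \<forall>p\<in>P. act g p = p}" using g by simp
qed (auto simp: mult one)

lemma uminus_mat_1_mult: "(- mat 1) ** A = - (A :: int ^ 'n ^ 'n::finite)" "A ** (- mat 1) = - A"
proof -
  have "((- mat 1) ** A) $ i $ j = (\<Sum>k\<in>UNIV. if k = i then - A $ i $ j else 0)" for i j
    unfolding matrix_matrix_mult_def vec_lambda_beta by (intro sum.cong) (auto simp: mat_def)
  then show "(- mat 1) ** A = - A" by (simp add: vec_eq_iff)
  have "(A ** (- mat 1)) $ i $ j = (\<Sum>k\<in>UNIV. if k = j then - A $ i $ j else 0)" for i j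
    unfolding matrix_matrix_mult_def vec_lambda_beta by (intro sum.cong) (auto simp: mat_def)
  then show "A ** (- mat 1) = - A" by (simp add: vec_eq_iff)
qed

lemma finite_Per_uminus: "finite (Per 1 (torus_map (- mat 1 :: int ^ 'n ^ 'n::finite)))"
proof (rule finite_subset)
  let ?S = "(\<lambda>f. to_torus (\<chi> i. f i)) ` (UNIV \<rightarrow>\<^sub>E {0, 1 / 2}) :: 'n torus set"
  show "finite ?S" by (intro finite_imageI finite_PiE) auto
  show "Per 1 (torus_map (- mat 1 :: int ^ 'n ^ 'n)) \<subseteq> ?S"
  proof
    fix \<theta> assume "\<theta> \<in> Per 1 (torus_map (- mat 1 :: int ^ 'n ^ 'n))"
    moreover obtain x where x: "\<theta> = to_torus x" by (rule to_torus_surj)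
    moreover have "real_matrix (- mat 1) = - (mat 1 :: real ^ 'n ^ 'n)"
      by (simp add: vec_eq_iff mat_def)
    then have "real_matrix (- mat 1) *v x = - x"
      by (metis add_eq_0_iff matrix_vector_mul_lid matrix_vector_mult_add_rdistrib
          matrix_vector_mult_0 right_minus)
    ultimately have "- x $ i - x $ i \<in> \<int>" for i
      by (simp add: Per_def torus_map_to_torus to_torus_eq_iff lattice_rel_def)
    then have half: "frac (x $ i) \<in> {0, 1 / 2}" for i
    proof -
      obtain m :: int where m: "- x $ i - x $ i = of_int m"
        using \<open>\<And>i. - x $ i - x $ i \<in> \<int>\<close> by (metis Ints_cases)
      define q where "q = frac (x $ i)"
      define n where "n = - m - 2 * \<lfloor>x $ i\<rfloor>"
      have q: "2 * q = of_int n" using m by (simp add: q_def n_def frac_def)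
      moreover have "0 \<le> q" "q < 1"
        unfolding q_def by (rule frac_ge_0, rule frac_lt_1)
      ultimately have "n = 0 \<or> n = 1" by linarith
      then have "q \<in> {0, 1 / 2}" using q by auto
      then show ?thesis by (simp only: q_def)
    qed
    have "\<theta> = to_torus (\<chi> i. frac (x $ i))"
      by (simp add: x to_torus_eq_iff lattice_rel_def frac_def)
    moreover have "(\<lambda>i. frac (x $ i)) \<in> UNIV \<rightarrow>\<^sub>E {0, 1 / 2}"
      by (intro PiE_I) (use half in \<open>simp_all only: UNIV_I not_True_eq_False\<close>)
    ultimately show "\<theta> \<in> ?S" by (rule image_eqI)
  qed
qed

lemma centralizer_fixing_periodic_points:
  fixes A J B :: "int ^ 'n ^ 'n::finite"
  assumes A: "A \<in> carrier GLZ"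
    and hyp: "hyperbolic A"
    and J: "J \<in> centralizer_GLZ A"
    and idp: "internal_direct_product (GLZ\<lparr>carrier := centralizer_GLZ A\<rparr>)
           (cyclic_subgroup GLZ A) (cyclic_subgroup GLZ J)"
    and ord: "group.ord GLZ J = 2 ^ b"
    and card: "card (Per 1 (torus_map A)) > card (Per 1 (torus_map (- mat 1 :: int ^ 'n ^ 'n)))"
    and B: "B \<in> centralizer_GLZ A"
    and fix_Per: "\<And>\<theta>. \<theta> \<in> Per 1 (torus_map A) \<Longrightarrow> torus_map B \<theta> = \<theta>"
  obtains k :: int where "B = A [^]\<^bsub>GLZ\<^esub> k"
proof -
  interpret G: group "GLZ :: (int ^ 'n ^ 'n) monoid" by (rule group_GLZ)
  have J': "J \<in> carrier GLZ" using J by (simp add: centralizer_GLZ_def)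
  have int: "cyclic_subgroup GLZ A \<inter> cyclic_subgroup GLZ J = {mat 1}"
    and prod: "cyclic_subgroup GLZ A <#>\<^bsub>GLZ\<lparr>carrier := centralizer_GLZ A\<rparr>\<^esub> cyclic_subgroup GLZ J
        = centralizer_GLZ A"
    using idp by (simp_all add: internal_direct_product_def)
  have decomp: "\<exists>(k :: int) (l :: int). X = A [^]\<^bsub>GLZ\<^esub> k ** J [^]\<^bsub>GLZ\<^esub> l" if "X \<in> centralizer_GLZ A" for X
    using subsetD[OF equalityD2[OF prod] that] by (auto simp: set_mult_def cyclic_subgroup_def)
  define S where "S = {X \<in> carrier GLZ. \<forall>\<theta>\<in>Per 1 (torus_map A). torus_map X \<theta> = \<theta>}"
  have S: "subgroup S GLZ"
    unfolding S_def by (rule G.subgroup_pointwise_stabilizer) (simp_all add: torus_map_mult torus_map_mat_1 fun_eq_iff)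
  have AS: "A \<in> S" using A by (simp add: S_def Per_def)
  have BS: "B \<in> S" using B fix_Per by (simp add: S_def centralizer_GLZ_def)
  obtain k m :: int where km: "B = A [^]\<^bsub>GLZ\<^esub> k ** J [^]\<^bsub>GLZ\<^esub> m" using decomp[OF B] by blast
  have "inv\<^bsub>GLZ\<^esub> (A [^]\<^bsub>GLZ\<^esub> k) \<otimes>\<^bsub>GLZ\<^esub> B \<in> S"
    by (intro subgroup.m_closed[OF S] subgroup.m_inv_closed[OF S] G.subgroup_int_pow_closed[OF S] AS BS)
  moreover have "inv\<^bsub>GLZ\<^esub> (A [^]\<^bsub>GLZ\<^esub> k) \<otimes>\<^bsub>GLZ\<^esub> B = J [^]\<^bsub>GLZ\<^esub> m"
    using G.inv_solve_left[of "J [^]\<^bsub>GLZ\<^esub> m" "A [^]\<^bsub>GLZ\<^esub> k" B] A J' B km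
    by (simp add: centralizer_GLZ_def)
  ultimately have JmS: "J [^]\<^bsub>GLZ\<^esub> m \<in> S" by simp
  have "J [^]\<^bsub>GLZ\<^esub> m = mat 1"
  proof (rule ccontr)
    assume m: "J [^]\<^bsub>GLZ\<^esub> m \<noteq> mat 1"
    have sq: "(- mat 1) ** (- mat 1) = (mat 1 :: int ^ 'n ^ 'n)"
      by (simp add: uminus_mat_1_mult)
    then have "- mat 1 \<in> centralizer_GLZ A"
      using mem_GLZ_if_right_inverse[OF sq] by (simp add: centralizer_GLZ_def uminus_mat_1_mult)
    then obtain i l :: int where il: "- mat 1 = A [^]\<^bsub>GLZ\<^esub> i ** J [^]\<^bsub>GLZ\<^esub> l" using decomp by blast
    define X where "X = A [^]\<^bsub>GLZ\<^esub> i"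
    define Y where "Y = J [^]\<^bsub>GLZ\<^esub> l"
    have XY: "X \<in> carrier GLZ" "Y \<in> carrier GLZ" using A J' by (simp_all add: X_def Y_def)
    have "Y \<otimes>\<^bsub>GLZ\<^esub> A = A \<otimes>\<^bsub>GLZ\<^esub> Y"
      using G.subgroup_int_pow_closed[OF G.subgroup_commuting[OF A], of J l] J J'
      by (simp add: Y_def centralizer_GLZ_def)
    then have commute: "Y ** X = X ** Y"
      using G.subgroup_int_pow_closed[OF G.subgroup_commuting[OF XY(2)], of A i] A
      by (simp add: X_def)
    have "(X ** X) ** (Y ** Y) = X ** (Y ** X) ** Y"
      by (simp add: commute matrix_mul_assoc)
    also have "\<dots> = (X ** Y) ** (X ** Y)" by (simp add: matrix_mul_assoc)
    also have "\<dots> = mat 1" using sq il by (simp add: X_def Y_def)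
    finally have XXYY: "(X ** X) ** (Y ** Y) = mat 1" .
    then have "X ** X = inv\<^bsub>GLZ\<^esub> (Y ** Y)"
      using G.inv_equality[of "X ** X" "Y ** Y"] XY G.m_closed[of X X] G.m_closed[of Y Y] by simp
    also have "\<dots> = J [^]\<^bsub>GLZ\<^esub> (- (l + l))"
      using J' G.int_pow_mult[OF J', of l l] by (simp add: Y_def G.int_pow_neg del: minus_add_distrib)
    finally have "X ** X \<in> cyclic_subgroup GLZ J" by (auto simp: cyclic_subgroup_def)
    moreover have XX: "X ** X = A [^]\<^bsub>GLZ\<^esub> (i + i)"
      using G.int_pow_mult[OF A, of i i] by (simp add: X_def)
    then have "X ** X \<in> cyclic_subgroup GLZ A" by (auto simp: cyclic_subgroup_def)
    ultimately have XX1: "X ** X = mat 1" using int by blast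
    then have "i = 0" using XX hyperbolic_pow_eq_1_iff[OF A hyp, of "i + i"] by simp
    then have Y: "Y = - mat 1" using il by (simp add: Y_def)
    obtain t :: int where "(J [^]\<^bsub>GLZ\<^esub> m) [^]\<^bsub>GLZ\<^esub> t = J [^]\<^bsub>GLZ\<^esub> l"
      using G.involution_in_nontrivial_powers[OF J' ord, of m l] m XXYY XX1 by (auto simp: Y_def)
    then have "- mat 1 \<in> S"
      using G.subgroup_int_pow_closed[OF S JmS, of t] Y by (simp add: Y_def)
    then have "Per 1 (torus_map A) \<subseteq> Per 1 (torus_map (- mat 1 :: int ^ 'n ^ 'n))"
      by (auto simp: S_def Per_def)
    then show False using card card_mono[OF finite_Per_uminus] by (metis linorder_not_less)
  qed
  then have "B = A [^]\<^bsub>GLZ\<^esub> k" using km by simp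
  then show ?thesis by (rule that)
qed

section \<open>Centralizers of diffeomorphisms\<close>

lemma cspectrum_intertwine:
  assumes "M ** P = P ** N" "Q ** P = mat 1"
  shows "cspectrum N \<subseteq> cspectrum M"
proof
  fix \<mu> assume "\<mu> \<in> cspectrum N"
  then obtain v where v: "v \<noteq> 0" "N *v v = \<mu> *s v" by (auto simp: cspectrum_def)
  have "P *v v \<noteq> 0"
    using v(1) assms(2) by (metis matrix_vector_mul_assoc matrix_vector_mul_lid matrix_vector_mult_0_right)
  moreover have "M *v (P *v v) = \<mu> *s (P *v v)"
    using assms(1) v(2) by (metis matrix_vector_mul_assoc vector_scalar_commute)
  ultimately show "\<mu> \<in> cspectrum M" by (auto simp: cspectrum_def)
qed

lemma commuting_fixes_Per1:
  fixes f g :: "'n torus \<Rightarrow> 'n::finite torus"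
  assumes f: "f \<in> carrier Diff1" and spectra: "distinct_periodic_spectra 1 f"
    and g: "g \<in> centralizer_Diff1 f" and \<theta>: "\<theta> \<in> Per 1 f"
  shows "g \<theta> = \<theta>"
proof -
  interpret G: group "Diff1 :: ('n torus \<Rightarrow> 'n torus) monoid" by (rule group_Diff1)
  have g': "g \<in> carrier Diff1" and fg: "f \<circ> g = g \<circ> f" using g by (simp_all add: centralizer_Diff1_def)
  have f\<theta>: "f \<theta> = \<theta>" using \<theta> by (simp add: Per_def)
  have fg\<theta>: "f (g \<theta>) = g \<theta>" using fg f\<theta> by (metis comp_apply)
  have deriv: "has_torus_derivative k (torus_deriv k \<xi>) \<xi>" if "k \<in> carrier Diff1" for k \<xi>
    using that by (simp add: Diff1_def C1_map_has_torus_derivative)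
  define D where "D = torus_deriv f \<theta>"
  define D' where "D' = torus_deriv f (g \<theta>)"
  define P where "P = torus_deriv g \<theta>"
  define Q where "Q = torus_deriv (inv\<^bsub>Diff1\<^esub> g) (g \<theta>)"
  have inv: "inv\<^bsub>Diff1\<^esub> g \<circ> g = id" using G.l_inv[OF g'] by simp
  have "has_torus_derivative (f \<circ> g) (D' ** P) \<theta>"
    unfolding D'_def P_def by (intro has_torus_derivative_compose deriv f g')
  moreover have "has_torus_derivative (g \<circ> f) (P ** D) \<theta>"
    using has_torus_derivative_compose[OF deriv[OF f, of \<theta>] deriv[OF g']] by (simp add: f\<theta> P_def D_def)
  ultimately have DP: "D' ** P = P ** D" using has_torus_derivative_unique unfolding fg by blast
  have "has_torus_derivative (inv\<^bsub>Diff1\<^esub> g \<circ> g) (Q ** P) \<theta>"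
    unfolding Q_def P_def by (intro has_torus_derivative_compose deriv g' G.inv_closed)
  then have QP: "Q ** P = mat 1"
    using has_torus_derivative_unique[OF _ has_torus_derivative_id] unfolding inv by blast
  then have PQ: "P ** Q = mat 1" using matrix_left_right_inverse by blast
  let ?c = "map_matrix complex_of_real"
  have c_mult: "?c (X ** Y) = ?c X ** ?c Y" for X Y :: "real ^ 'n ^ 'n"
    by (simp add: vec_eq_iff matrix_matrix_mult_def)
  have c_one: "?c (mat 1 :: real ^ 'n ^ 'n) = mat 1" by (simp add: vec_eq_iff mat_def)
  have "cspectrum (?c D) = cspectrum (?c D')"
  proof
    show "cspectrum (?c D) \<subseteq> cspectrum (?c D')"
      by (rule cspectrum_intertwine[of _ "?c P" _ "?c Q"]) (simp_all add: DP QP c_one flip: c_mult)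
    have "D ** Q = Q ** D'"
      by (metis DP PQ QP matrix_mul_assoc matrix_mul_lid matrix_mul_rid)
    then show "cspectrum (?c D') \<subseteq> cspectrum (?c D)"
      by (intro cspectrum_intertwine[of _ "?c Q" _ "?c P"]) (simp_all add: PQ c_one flip: c_mult)
  qed
  then have "cspectrum (?c (torus_deriv (f ^^ 1) \<theta>)) = cspectrum (?c (torus_deriv (f ^^ 1) (g \<theta>)))"
    by (simp add: D_def D'_def)
  moreover have "g \<theta> \<in> Per 1 f" using fg\<theta> by (simp add: Per_def)
  ultimately have orbits: "torus_orbit f \<theta> = torus_orbit f (g \<theta>)"
    using spectra \<theta> unfolding distinct_periodic_spectra_def by blast
  have orbit: "torus_orbit f \<xi> = {\<xi>}" if "f \<xi> = \<xi>" for \<xi>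
  proof -
    have sub: "subgroup {k \<in> carrier Diff1. \<forall>p\<in>{\<xi>}. k p = p} Diff1"
      by (rule G.subgroup_pointwise_stabilizer) (simp_all add: fun_eq_iff)
    have "(f [^]\<^bsub>Diff1\<^esub> (k :: int)) \<xi> = \<xi>" for k
      using G.subgroup_int_pow_closed[OF sub, of f k] f that by simp
    then have fixed: "g \<xi> = \<xi>" if "g \<in> cyclic_subgroup Diff1 f" for g
      using that by (auto simp: cyclic_subgroup_def)
    have mem: "f \<in> cyclic_subgroup Diff1 f"
      unfolding cyclic_subgroup_def using G.int_pow_1[OF f] by (metis (mono_tags, lifting) mem_Collect_eq)
    have "torus_orbit f \<xi> = (\<lambda>g. g \<xi>) ` cyclic_subgroup Diff1 f"
      by (auto simp: torus_orbit_def)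
    also have "\<dots> = (\<lambda>g. \<xi>) ` cyclic_subgroup Diff1 f" by (intro image_cong) (simp_all add: fixed)
    also have "\<dots> = {\<xi>}" using mem by auto
    finally show ?thesis .
  qed
  show ?thesis using orbits orbit[OF f\<theta>] orbit[OF fg\<theta>] by simp
qed

lemma conjugate_int_pow:
  fixes f h :: "'n torus \<Rightarrow> 'n::finite torus"
  assumes f: "f \<in> carrier Diff1" and A: "A \<in> carrier GLZ" and conj: "h \<circ> f = torus_map A \<circ> h"
  shows "h \<circ> f [^]\<^bsub>Diff1\<^esub> (k :: int) = torus_map (A [^]\<^bsub>GLZ\<^esub> k) \<circ> h"
proof -
  interpret D: group "Diff1 :: ('n torus \<Rightarrow> 'n torus) monoid" by (rule group_Diff1)
  interpret G: group "GLZ :: (int ^ 'n ^ 'n) monoid" by (rule group_GLZ)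
  have nat: "h \<circ> f [^]\<^bsub>Diff1\<^esub> i = torus_map (A [^]\<^bsub>GLZ\<^esub> i) \<circ> h" for i :: nat
  proof (induction i)
    case (Suc i)
    then show ?case using conj by (simp add: torus_map_mult fun_eq_iff)
  qed (simp add: torus_map_mat_1)
  show ?thesis
  proof (cases k rule: int_cases2)
    case (nonneg i)
    then show ?thesis using nat[of i] by (simp add: int_pow_int)
  next
    case (nonpos i)
    define F where "F = f [^]\<^bsub>Diff1\<^esub> i"
    define M where "M = A [^]\<^bsub>GLZ\<^esub> i"
    have F: "F \<in> carrier Diff1" using f by (simp add: F_def)
    have M: "M \<in> carrier GLZ" using A by (simp add: M_def)
    have "h \<circ> inv\<^bsub>Diff1\<^esub> F = torus_map (inv\<^bsub>GLZ\<^esub> M ** M) \<circ> h \<circ> inv\<^bsub>Diff1\<^esub> F"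
      using G.l_inv[OF M] by (simp add: torus_map_mat_1)
    also have "\<dots> = torus_map (inv\<^bsub>GLZ\<^esub> M) \<circ> (h \<circ> F) \<circ> inv\<^bsub>Diff1\<^esub> F"
      unfolding F_def nat by (simp add: torus_map_mult comp_assoc M_def)
    also have "\<dots> = torus_map (inv\<^bsub>GLZ\<^esub> M) \<circ> h"
      using D.r_inv[OF F] by (simp add: comp_assoc)
    finally show ?thesis
      using f A nonpos by (simp add: D.int_pow_neg_int G.int_pow_neg_int F_def M_def)
  qed
qed

theorem theorem4p4:
  fixes A J :: "int ^ 'n ^ 'n::finite" and b :: nat and e :: real
    and U U\<^sub>1 :: "('n torus \<Rightarrow> 'n torus) set"
    and h :: "('n torus \<Rightarrow> 'n torus) \<Rightarrow> 'n torus \<Rightarrow> 'n torus"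
  assumes "A \<in> carrier GLZ"
    and "hyperbolic A"
    and "e > 0"
    and "structural_stability_nbhd A U h e"
    and "distinct_spectra_set 1 A U U\<^sub>1"
    and "J \<in> centralizer_GLZ A"
    and "internal_direct_product (GLZ\<lparr>carrier := centralizer_GLZ A\<rparr>)
           (cyclic_subgroup GLZ A) (cyclic_subgroup GLZ J)"
    and "group.ord GLZ J = 2 ^ b"
    and "card (Per 1 (torus_map A)) > card (Per 1 (torus_map (- mat 1 :: int ^ 'n ^ 'n)))"
  shows "\<forall>f\<in>U\<^sub>1. centralizer_Diff1 f = cyclic_subgroup Diff1 f"
proof
  fix f assume f1: "f \<in> U\<^sub>1"
  interpret D: group "Diff1 :: ('n torus \<Rightarrow> 'n torus) monoid" by (rule group_Diff1)
  interpret G: group "GLZ :: (int ^ 'n ^ 'n) monoid" by (rule group_GLZ)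
  note A = assms(1)
  have spectra: "distinct_periodic_spectra 1 f" and "f \<in> U"
    using assms(5) f1 by (auto simp: distinct_spectra_set_def)
  define k where "k = h f"
  define k' where "k' = inv_into UNIV k"
  have "anosov f" and homeo: "homeomorphism UNIV UNIV k k'" and "k \<circ> f \<circ> k' = torus_map A"
    using assms(4) \<open>f \<in> U\<close> by (auto simp: structural_stability_nbhd_def k_def k'_def)
  then have f: "f \<in> carrier Diff1" by (simp add: anosov_def)
  have kk': "k' \<circ> k = id" "k \<circ> k' = id" and cont: "continuous_on UNIV k" "continuous_on UNIV k'"
    using homeo by (auto simp: homeomorphism_def)
  have conj: "k \<circ> f = torus_map A \<circ> k"
    using \<open>k \<circ> f \<circ> k' = torus_map A\<close> kk' by (metis comp_assoc comp_id)
  have cancel: "p = q" if "p \<circ> k = q \<circ> k" for p q :: "'n torus \<Rightarrow> 'n torus"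
    using that kk'(2) by (metis comp_assoc comp_id)
  have centralizer: "centralizer_Diff1 f = {g \<in> carrier Diff1. f \<otimes>\<^bsub>Diff1\<^esub> g = g \<otimes>\<^bsub>Diff1\<^esub> f}"
    by (simp add: centralizer_Diff1_def)
  have sub: "subgroup (centralizer_Diff1 f) Diff1"
    unfolding centralizer by (rule D.subgroup_commuting[OF f])
  obtain A' where A': "A' ** A = mat 1" "A ** A' = mat 1"
    using G.l_inv[OF A] G.r_inv[OF A] by auto
  have fix_Per: "k (g (k' \<theta>)) = \<theta>" if "g \<in> centralizer_Diff1 f" "\<theta> \<in> Per 1 (torus_map A)" for g \<theta>
  proof -
    have "k (f (k' \<theta>)) = \<theta>"
      using that(2) \<open>k \<circ> f \<circ> k' = torus_map A\<close> by (auto simp: Per_def fun_eq_iff)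
    then have "k' \<theta> \<in> Per 1 f" using kk' by (auto simp: Per_def fun_eq_iff) metis
    then show ?thesis using commuting_fixes_Per1[OF f spectra that(1)] kk' by (simp add: fun_eq_iff)
  qed
  have linear: "\<exists>B. k \<circ> g = torus_map B \<circ> k" if g: "g \<in> centralizer_Diff1 f" for g
  proof -
    have fg: "f \<circ> g = g \<circ> f" and "C1_map g" using g by (auto simp: centralizer_Diff1_def Diff1_def)
    define \<phi> where "\<phi> = k \<circ> g \<circ> k'"
    have "continuous_on UNIV \<phi>"
      unfolding \<phi>_def comp_def
      by (intro continuous_on_compose2[OF cont(1)] cont(2)
          continuous_on_compose2[OF C1_map_imp_continuous[OF \<open>C1_map g\<close>]]) auto
    moreover have "\<phi> \<circ> torus_map A = torus_map A \<circ> \<phi>"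
    proof (rule cancel)
      have "\<phi> \<circ> torus_map A \<circ> k = k \<circ> g \<circ> k' \<circ> (k \<circ> f)" by (simp add: \<phi>_def conj comp_assoc)
      also have "\<dots> = k \<circ> (g \<circ> f)" using kk'(1) by (simp add: fun_eq_iff)
      also have "\<dots> = (k \<circ> f) \<circ> g" by (simp add: fg[symmetric] comp_assoc)
      also have "\<dots> = torus_map A \<circ> \<phi> \<circ> k" using kk'(1) by (simp add: conj \<phi>_def fun_eq_iff)
      finally show "\<phi> \<circ> torus_map A \<circ> k = torus_map A \<circ> \<phi> \<circ> k" .
    qed
    moreover have "\<phi> (to_torus 0) = to_torus 0"
      unfolding \<phi>_def comp_apply
      by (rule fix_Per[OF g]) (simp add: Per_def torus_map_to_torus)
    ultimately obtain B where "\<phi> = torus_map B"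
      using commuting_with_hyperbolic_imp_torus_map[OF assms(2) A'] by blast
    moreover have "k \<circ> g = \<phi> \<circ> k" using kk'(1) by (simp add: \<phi>_def fun_eq_iff)
    ultimately show ?thesis by blast
  qed
  show "centralizer_Diff1 f = cyclic_subgroup Diff1 f"
  proof
    have "f \<in> centralizer_Diff1 f" using f by (simp add: centralizer)
    then show "cyclic_subgroup Diff1 f \<subseteq> centralizer_Diff1 f"
      using D.subgroup_int_pow_closed[OF sub] by (auto simp: cyclic_subgroup_def)
    show "centralizer_Diff1 f \<subseteq> cyclic_subgroup Diff1 f"
    proof
      fix g assume g: "g \<in> centralizer_Diff1 f"
      then have g': "g \<in> carrier Diff1" and fg: "f \<circ> g = g \<circ> f" by (simp_all add: centralizer)
      obtain B where B: "k \<circ> g = torus_map B \<circ> k" using linear[OF g] by blast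
      obtain C where C: "k \<circ> inv\<^bsub>Diff1\<^esub> g = torus_map C \<circ> k"
        using linear[OF subgroup.m_inv_closed[OF sub g]] by blast
      have "torus_map (B ** C) \<circ> k = torus_map B \<circ> (k \<circ> inv\<^bsub>Diff1\<^esub> g)"
        by (simp add: torus_map_mult comp_assoc C)
      also have "\<dots> = k \<circ> (g \<circ> inv\<^bsub>Diff1\<^esub> g)" by (simp add: B flip: comp_assoc)
      also have "\<dots> = torus_map (mat 1) \<circ> k" using D.r_inv[OF g'] by (simp add: torus_map_mat_1)
      finally have "B ** C = mat 1" by (rule inj_torus_map[OF cancel])
      then have "B \<in> carrier GLZ" by (rule mem_GLZ_if_right_inverse)
      moreover have "torus_map (B ** A) \<circ> k = torus_map (A ** B) \<circ> k"
      proof -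
        have "torus_map (B ** A) \<circ> k = k \<circ> (g \<circ> f)"
          using B conj by (simp add: torus_map_mult fun_eq_iff)
        also have "\<dots> = torus_map (A ** B) \<circ> k"
          unfolding fg[symmetric] using B conj by (simp add: torus_map_mult fun_eq_iff)
        finally show ?thesis .
      qed
      then have "B ** A = A ** B" by (rule inj_torus_map[OF cancel])
      ultimately have "B \<in> centralizer_GLZ A" by (simp add: centralizer_GLZ_def)
      moreover have "torus_map B \<theta> = \<theta>" if "\<theta> \<in> Per 1 (torus_map A)" for \<theta>
      proof -
        have "torus_map B \<theta> = k (g (k' \<theta>))"
          using B kk'(2) by (metis comp_apply id_apply)
        then show ?thesis using fix_Per[OF g that] by simp
      qed
      ultimately obtain i :: int where "B = A [^]\<^bsub>GLZ\<^esub> i"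
        using centralizer_fixing_periodic_points[OF A assms(2,6-9)] by blast
      then have "k \<circ> g = k \<circ> f [^]\<^bsub>Diff1\<^esub> i" using B conjugate_int_pow[OF f A conj] by simp
      then have "g = f [^]\<^bsub>Diff1\<^esub> i" using kk'(1) by (metis comp_assoc id_comp)
      then show "g \<in> cyclic_subgroup Diff1 f" by (auto simp: cyclic_subgroup_def)
    qed
  qed
qed

end
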